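(* Let $\mathcal{A}$ be an arrangement of linear hyperplanes in a linear subspace $U$ of $\mathbb{R}^d$, with lattice of flats $\mathcal{L}(\mathcal{A})$, minimal element $\hat{0}=U$ and Möbius function $\mu=\mu_{\mathcal{L}(\mathcal{A})}$. For all $0\le k\le d$, as elements in $\mathfrak{C}_d$: \[ V_k(\mathcal{A}) \ = \ \sum_{L\in\mathcal{L}_k(\mathcal{A})} \Big(\sum_{\substack{K\in\mathcal{L}(\mathcal{A})\\ K\subseteq L}} |\mu(L,K)|\cdot[K]\Big) \ast \Big(\sum_{\substack{M\in\mathcal{L}(\mathcal{A})\\ L\subseteq M}} |\mu(\hat{0},M)|\cdot[M^\perp]\Big) \, , \] where $\mathcal{L}_k(\mathcal{A})$ is the set of flats of dimension $k$ and $M^\perp$ is the orthogonal complement of $M$ in $\mathbb{R}^d$.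
   Context: Polyhedral cones are nonempty and contain the origin; $\mathbf{Cones}_d$ is the set of polyhedral cones in $\mathbb{R}^d$. For $S\subseteq\mathbb{R}^d$, $[S]:\mathbb{R}^d\to\{0,1\}$ is the indicator function of $S$. $\mathfrak{C}_d$ is the abelian group of functions $\mathbb{R}^d\to\mathbb{Z}$ spanned by all $[C]$, $C\in\mathbf{Cones}_d$. It carries a ring structure $(\mathfrak{C}_d,+,\ast)$ whose bilinear product $\ast$ is determined by $[C]\ast[C']=[\mathrm{cone}(C\cup C')]=[C+C']$ for $C,C'\in\mathbf{Cones}_d$. For a cone $C$, $\mathcal{F}_k(C)$ is the set of $k$-dimensional nonempty faces of $C$ (including $C$ itself if $k = \dim C$). For a nonempty face $F$ of $C$, $N_FC=\{c\in\mathbb{R}^d : \langle c,x\rangle\le\langle c,y\rangle \text{ for all } x\in C,\ y\in F\}$, and $\Pi_F(C)=F+N_FC$. Define $V_k(C)=\sum_{F\in\mathcal{F}_k(C)}[\Pi_F(C)]\in\mathfrak{C}_d$. A hyperplane arrangement in a linear subspace $U$ of $\mathbb{R}^d$ is a finite collection $\mathcal{A}$ of linear hyperplanes of $U$; $\mathcal{N}(\mathcal{A})$ is the fan consisting of the closures of the connected components of $U\setminus\bigcup\mathcal{A}$, and $V_k(\mathcal{A})=V_k(\mathcal{N}(\mathcal{A}))=\sum_{C\in\mathcal{N}(\mathcal{A})}V_k(C)\in\mathfrak{C}_d$. The lattice of flats $\mathcal{L}(\mathcal{A})$ is the collection of all linear subspaces arising as intersections of hyperplanes in $\mathcal{A}$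 (including $U$ as the empty intersection), ordered by reverse inclusion. The Möbius function is $\mu(x,x)=1$ and $\mu(x,y)=-\sum_{x\preceq z\prec y}\mu(x,z)$ for $x\prec y$. *)

theory Defs
  imports "HOL-Analysis.Analysis"
begin

section \<open>The group spanned by indicators of polyhedral cones\<close>

definition Cones :: "'a::euclidean_space set set" where
  "Cones = {C. polyhedron C \<and> cone C \<and> C \<noteq> {}}"

definition cone_group :: "('a::euclidean_space \<Rightarrow> int) set" where
  "cone_group = {f. \<exists>S a. finite S \<and> S \<subseteq> Cones \<and> f = (\<lambda>x. \<Sum>C\<in>S. a C * indicator C x)}"

section \<open>The product on the cone group\<close>

definition is_cone_product ::
    "(('a::euclidean_space \<Rightarrow> int) \<Rightarrow> ('a \<Rightarrow> int) \<Rightarrow> ('a \<Rightarrow> int)) \<Rightarrow> bool" where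
  "is_cone_product m \<longleftrightarrow>
     (\<forall>f\<in>cone_group. \<forall>g\<in>cone_group. \<forall>h\<in>cone_group.
        m (\<lambda>x. f x + g x) h = (\<lambda>x. m f h x + m g h x) \<and>
        m h (\<lambda>x. f x + g x) = (\<lambda>x. m h f x + m h g x)) \<and>
     (\<forall>C\<in>Cones. \<forall>D\<in>Cones. m (indicator C) (indicator D) = indicator (C + D))"

text \<open>
  The product is the biadditive operation with \<open>[C] \<star> [D] = [C + D]\<close>. These conditions determine it
  only on \<^const>\<open>cone_group\<close>; its values elsewhere are arbitrary. Existence
  (\<open>is_cone_product_cone_product\<close>) and uniqueness (\<open>is_cone_product_unique\<close>) are proved at the end
  of the theory.
\<close>

definition cone_product ::
    "('a::euclidean_space \<Rightarrow> int) \<Rightarrow> ('a \<Rightarrow> int) \<Rightarrow> ('a \<Rightarrow> int)" (infixl "\<star>" 70) where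
  "cone_product = (SOME m. is_cone_product m)"

section \<open>Faces, normal cones and the functions \<open>V\<^sub>k\<close>\<close>

definition faces_dim :: "nat \<Rightarrow> 'a::euclidean_space set \<Rightarrow> 'a set set" where
  "faces_dim k C = {F. F face_of C \<and> F \<noteq> {} \<and> aff_dim F = int k}"

definition normal_cone :: "'a::euclidean_space set \<Rightarrow> 'a set \<Rightarrow> 'a set" where
  "normal_cone F C = {c. \<forall>x\<in>C. \<forall>y\<in>F. c \<bullet> x \<le> c \<bullet> y}"

definition Pi_face :: "'a::euclidean_space set \<Rightarrow> 'a set \<Rightarrow> 'a set" where
  "Pi_face F C = F + normal_cone F C"

definition V_cone :: "nat \<Rightarrow> 'a::euclidean_space set \<Rightarrow> 'a \<Rightarrow> int" where
  "V_cone k C = (\<lambda>x. \<Sum>F\<in>faces_dim k C. indicator (Pi_face F C) x)"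

section \<open>Hyperplane arrangements\<close>

definition hyperplane_arrangement :: "'a::euclidean_space set \<Rightarrow> 'a set set \<Rightarrow> bool" where
  "hyperplane_arrangement U \<A> \<longleftrightarrow>
     subspace U \<and> finite \<A> \<and> (\<forall>H\<in>\<A>. subspace H \<and> H \<subseteq> U \<and> dim H + 1 = dim U)"

definition arrangement_fan :: "'a::euclidean_space set \<Rightarrow> 'a set set \<Rightarrow> 'a set set" where
  "arrangement_fan U \<A> = closure ` components (U - \<Union>\<A>)"

definition V_arr :: "nat \<Rightarrow> 'a::euclidean_space set \<Rightarrow> 'a set set \<Rightarrow> 'a \<Rightarrow> int" where
  "V_arr k U \<A> = (\<lambda>x. \<Sum>C\<in>arrangement_fan U \<A>. V_cone k C x)"

definition flats :: "'a::euclidean_space set \<Rightarrow> 'a set set \<Rightarrow> 'a set set" where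
  "flats U \<A> = {U \<inter> \<Inter>\<B> |\<B>. \<B> \<subseteq> \<A>}"

text \<open>
  The Moebius function of a finite family \<open>P\<close> of sets ordered by \<^emph>\<open>reverse\<close> inclusion, so that
  \<open>x \<preceq> y\<close> means \<open>y \<subseteq> x\<close>. It is set to \<open>0\<close> on pairs that are not comparable in this direction.
\<close>

function mobius :: "'b set set \<Rightarrow> 'b set \<Rightarrow> 'b set \<Rightarrow> int" where
  "mobius P x y =
     (if x = y then 1
      else if finite P \<and> y \<subset> x then - (\<Sum>z\<in>{z\<in>P. z \<subseteq> x \<and> y \<subset> z}. mobius P x z)
      else 0)"
  by auto
termination
proof (relation "Wellfounded.measure (\<lambda>(P, x, y). card {z\<in>P. y \<subset> z})", goal_cases)
  case (2 P x y z)
  then have "{w\<in>P. z \<subset> w} \<subset> {w\<in>P. y \<subset> w}" by auto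
  then show ?case using 2 by (auto intro!: psubset_card_mono)
qed auto

declare mobius.simps [simp del]

section \<open>Existence and uniqueness of the product\<close>

text \<open>
  Existence rests on the Euler characteristic: an integer linear relation between indicators of
  polyhedra remains valid when the indicator of each nonempty polyhedron is replaced by \<open>1\<close>.
  This is proved by projecting out one coordinate at a time.
\<close>

declare sum_mult_indicator [simp del] sum_indicator_mult [simp del]

lemma euler_real:
  fixes A :: "'i \<Rightarrow> real set" and a :: "'i \<Rightarrow> int"
  assumes fin: "finite I" and cl: "\<And>i. i \<in> I \<Longrightarrow> closed (A i)" and cv: "\<And>i. i \<in> I \<Longrightarrow> convex (A i)"
    and rel: "\<And>t. (\<Sum>i\<in>I. a i * indicator (A i) t) = 0"
  shows "(\<Sum>i\<in>I. a i * of_bool (A i \<noteq> {})) = 0"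
proof -
  define M where "M i t \<longleftrightarrow> (\<exists>y\<in>A i. y \<le> t)" for i t
  define B where "B i t \<longleftrightarrow> A i \<noteq> {} \<and> (\<forall>y\<in>A i. y < t)" for i t
  define G where "G t = (\<Sum>i\<in>I. a i * of_bool (M i t))" for t
  define H where "H t = (\<Sum>i\<in>I. a i * of_bool (B i t))" for t
  have MB: "of_bool (M i t) = indicator (A i) t + (of_bool (B i t) :: int)" if "i \<in> I" for i t
  proof (cases "t \<in> A i")
    case True then show ?thesis by (auto simp: M_def B_def)
  next
    case False
    have "B i t" if "M i t"
    proof -
      obtain y where y: "y \<in> A i" "y \<le> t" using \<open>M i t\<close> M_def by auto
      have "z < t" if z: "z \<in> A i" for z
      proof (rule ccontr)
        assume "\<not> z < t"
        then have "t \<in> A i"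
          using cv[OF \<open>i \<in> I\<close>] y z by (meson mem_is_interval_1_I is_interval_convex_1 not_less)
        with False show False by simp
      qed
      then show ?thesis using y by (auto simp: B_def)
    qed
    moreover have "M i t" if "B i t" using that by (force simp: M_def B_def)
    ultimately show ?thesis using False by auto
  qed
  have GH: "G t = H t" for t
  proof -
    have "G t = (\<Sum>i\<in>I. a i * indicator (A i) t) + H t"
      unfolding G_def H_def by (simp add: MB algebra_simps sum.distrib)
    then show ?thesis using rel by simp
  qed
  have right: "eventually (\<lambda>u. G s = G u) (at_right s)" for s
  proof -
    have "eventually (\<lambda>u. M i s = M i u) (at_right s)" if "i \<in> I" for i
    proof (cases "M i s")
      case True
      then have "M i u" if "s < u" for u
        using that unfolding M_def by (meson less_imp_le order_trans)
      then show ?thesis using True by (auto simp: eventually_at_right_less eventually_at_filter)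
    next
      case False
      then have "s \<in> - A i" by (auto simp: M_def)
      moreover have "open (- A i)" using cl[OF that] by auto
      ultimately obtain e where e: "e > 0" "ball s e \<subseteq> - A i" by (meson open_contains_ball)
      have "\<not> M i u" if "s < u" "u < s + e" for u
      proof
        assume "M i u"
        then obtain y where y: "y \<in> A i" "y \<le> u" by (auto simp: M_def)
        with False have "s < y" by (force simp: M_def)
        then have "y \<in> ball s e" using y that by (auto simp: dist_real_def)
        with e y show False by auto
      qed
      then show ?thesis using False e(1)
        by (auto simp: eventually_at_right_field intro!: exI[of _ "s + e"])
    qed
    then have "eventually (\<lambda>u. \<forall>i\<in>I. M i s = M i u) (at_right s)"
      by (simp add: eventually_ball_finite_distrib fin)
    then show ?thesis by (rule eventually_mono) (auto simp: G_def intro!: sum.cong)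
  qed
  have left: "eventually (\<lambda>u. H s = H u) (at_left s)" for s
  proof -
    have "eventually (\<lambda>u. B i s = B i u) (at_left s)" if "i \<in> I" for i
    proof (cases "B i s")
      case True
      then have "s \<in> - A i" by (auto simp: B_def)
      moreover have "open (- A i)" using cl[OF that] by auto
      ultimately obtain e where e: "e > 0" "ball s e \<subseteq> - A i" by (meson open_contains_ball)
      have "B i u" if "u < s" "s - e < u" for u
      proof -
        have "y < u" if y: "y \<in> A i" for y
        proof (rule ccontr)
          assume "\<not> y < u"
          then have "y \<in> ball s e" using True y \<open>u < s\<close> \<open>s - e < u\<close>
            by (auto simp: dist_real_def B_def)
          with e y show False by auto
        qed
        with True show ?thesis by (auto simp: B_def)
      qed
      then show ?thesis using True e(1)
        by (auto simp: eventually_at_left_field intro!: exI[of _ "s - e"])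
    next
      case False
      then have "\<not> B i u" if "u < s" for u using that unfolding B_def by force
      then show ?thesis using False by (auto simp: eventually_at_filter)
    qed
    then have "eventually (\<lambda>u. \<forall>i\<in>I. B i s = B i u) (at_left s)"
      by (simp add: eventually_ball_finite_distrib fin)
    then show ?thesis by (rule eventually_mono) (auto simp: H_def intro!: sum.cong)
  qed
  have const: "G s = G t" for s t
  proof (rule connected_local_const[where A = UNIV and f = G])
    show "\<forall>s\<in>UNIV. eventually (\<lambda>u. G s = G u) (at s within UNIV)"
      using right left by (auto simp: eventually_at_split GH)
  qed auto
  have "eventually (\<lambda>t. \<forall>i\<in>I. \<not> B i t) at_bot"
  proof (rule eventually_ball_finite[OF fin], intro ballI)
    fix i assume "i \<in> I"
    show "eventually (\<lambda>t. \<not> B i t) at_bot"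
    proof (cases "A i = {}")
      case False
      then obtain y where "y \<in> A i" by auto
      then have "\<not> B i t" if "t \<le> y" for t using that by (force simp: B_def)
      then show ?thesis by (auto simp: eventually_at_bot_linorder)
    qed (auto simp: B_def)
  qed
  then obtain s where "\<forall>i\<in>I. \<not> B i s" by (auto simp: eventually_at_bot_linorder)
  then have "G s = 0" by (simp add: GH H_def)
  have "eventually (\<lambda>t. \<forall>i\<in>I. M i t = (A i \<noteq> {})) at_top"
  proof (rule eventually_ball_finite[OF fin], intro ballI)
    fix i assume "i \<in> I"
    show "eventually (\<lambda>t. M i t = (A i \<noteq> {})) at_top"
    proof (cases "A i = {}")
      case False
      then obtain y where "y \<in> A i" by auto
      then have "M i t" if "y \<le> t" for t using that by (force simp: M_def)
      then show ?thesis using False by (auto simp: eventually_at_top_linorder)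
    qed (auto simp: M_def)
  qed
  then obtain t where "\<forall>i\<in>I. M i t = (A i \<noteq> {})" by (auto simp: eventually_at_top_linorder)
  then have "G t = (\<Sum>i\<in>I. a i * of_bool (A i \<noteq> {}))" by (simp add: G_def)
  with \<open>G s = 0\<close> const show ?thesis by metis
qed

lemma finite_interval_nonempty:
  fixes L R :: "real set"
  assumes "finite L" "finite R" "\<And>l r. l \<in> L \<Longrightarrow> r \<in> R \<Longrightarrow> l \<le> r"
  shows "\<exists>t. (\<forall>l\<in>L. l \<le> t) \<and> (\<forall>r\<in>R. t \<le> r)"
proof (cases "L = {}")
  case False
  then have "Max L \<in> L" using assms by simp
  then show ?thesis using assms by (intro exI[of _ "Max L"]) auto
next
  case True
  show ?thesis
  proof (cases "R = {}")
    case False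
    then show ?thesis using True assms by (intro exI[of _ "Min R"]) auto
  qed (use True in auto)
qed

lemma polyhedron_project:
  fixes S :: "'a::euclidean_space set"
  assumes "polyhedron S"
  shows "polyhedron {x. \<exists>t. x + t *\<^sub>R b \<in> S}"
proof -
  obtain F where F: "finite F" "S = \<Inter>F" "\<forall>h\<in>F. \<exists>a \<beta>. a \<noteq> 0 \<and> h = {x. a \<bullet> x \<le> \<beta>}"
    using assms unfolding polyhedron_def by auto
  then obtain a \<beta> where h: "\<And>h. h \<in> F \<Longrightarrow> h = {x. a h \<bullet> x \<le> \<beta> h}" by metis
  have S: "x \<in> S \<longleftrightarrow> (\<forall>h\<in>F. a h \<bullet> x \<le> \<beta> h)" for x using F(2) h by blast
  define Z where "Z = {h\<in>F. a h \<bullet> b = 0}"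
  define P where "P = {h\<in>F. a h \<bullet> b > 0}"
  define N where "N = {h\<in>F. a h \<bullet> b < 0}"
  have fin: "finite Z" "finite P" "finite N" using F by (auto simp: Z_def P_def N_def)
  define q where "q h x = (\<beta> h - a h \<bullet> x) / (a h \<bullet> b)" for h x
  have eq: "x + t *\<^sub>R b \<in> S \<longleftrightarrow>
      (\<forall>h\<in>Z. a h \<bullet> x \<le> \<beta> h) \<and> (\<forall>h\<in>N. q h x \<le> t) \<and> (\<forall>h\<in>P. t \<le> q h x)" for x t
  proof -
    have 1: "a h \<bullet> (x + t *\<^sub>R b) \<le> \<beta> h \<longleftrightarrow> a h \<bullet> x \<le> \<beta> h" if "h \<in> Z" for h
      using that by (simp add: Z_def inner_add_right)
    have 2: "a h \<bullet> (x + t *\<^sub>R b) \<le> \<beta> h \<longleftrightarrow> q h x \<le> t" if "h \<in> N" for h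
      using that by (simp add: N_def q_def inner_add_right neg_divide_le_eq algebra_simps)
    have 3: "a h \<bullet> (x + t *\<^sub>R b) \<le> \<beta> h \<longleftrightarrow> t \<le> q h x" if "h \<in> P" for h
      using that by (simp add: P_def q_def inner_add_right pos_le_divide_eq algebra_simps)
    have "F = Z \<union> N \<union> P" by (auto simp: Z_def N_def P_def)
    then show ?thesis unfolding S using 1 2 3 by auto
  qed
  have "(\<exists>t. x + t *\<^sub>R b \<in> S) \<longleftrightarrow>
      (\<forall>h\<in>Z. a h \<bullet> x \<le> \<beta> h) \<and> (\<forall>n\<in>N. \<forall>p\<in>P. q n x \<le> q p x)" (is "?L x \<longleftrightarrow> ?R x") for x
  proof
    assume R: "?R x"
    have "\<exists>t. (\<forall>l\<in>(\<lambda>h. q h x) ` N. l \<le> t) \<and> (\<forall>r\<in>(\<lambda>h. q h x) ` P. t \<le> r)"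
      using fin R by (intro finite_interval_nonempty) auto
    then show "?L x" using R unfolding eq by auto
  qed (unfold eq, meson order_trans)
  then have "{x. \<exists>t. x + t *\<^sub>R b \<in> S} =
      \<Inter>((\<lambda>h. {x. a h \<bullet> x \<le> \<beta> h}) ` Z) \<inter> \<Inter>((\<lambda>(n, p). {x. q n x \<le> q p x}) ` (N \<times> P))"
    by auto
  moreover have "polyhedron {x. q n x \<le> q p x}" for n p
  proof -
    have "{x. q n x \<le> q p x} = {x. (a p /\<^sub>R (a p \<bullet> b) - a n /\<^sub>R (a n \<bullet> b)) \<bullet> x
        \<le> \<beta> p / (a p \<bullet> b) - \<beta> n / (a n \<bullet> b)}"
      by (auto simp: q_def inner_diff_left diff_divide_distrib field_class.field_divide_inverse
          algebra_simps)
    then show ?thesis by (simp add: polyhedron_halfspace_le)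
  qed
  ultimately show ?thesis
    using fin by (auto intro!: polyhedron_Int polyhedron_Inter polyhedron_halfspace_le)
qed

lemma euler_project:
  fixes P :: "'i \<Rightarrow> 'a::euclidean_space set" and a :: "'i \<Rightarrow> int"
  assumes fin: "finite I" and poly: "\<And>i. i \<in> I \<Longrightarrow> polyhedron (P i)"
    and rel: "\<And>x. (\<Sum>i\<in>I. a i * indicator (P i) x) = 0"
  shows "(\<Sum>i\<in>I. a i * indicator {x. \<exists>t. x + t *\<^sub>R b \<in> P i} x) = 0"
proof -
  define A where "A i = {t. x + t *\<^sub>R b \<in> P i}" for i
  have A: "A i = (\<lambda>t. x + t *\<^sub>R b) -` P i" for i by (auto simp: A_def)
  have "(\<Sum>i\<in>I. a i * of_bool (A i \<noteq> {})) = 0"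
  proof (rule euler_real[OF fin])
    fix i assume i: "i \<in> I"
    have "closed (P i)" using poly[OF i] polyhedron_imp_closed by blast
    then show "closed (A i)" unfolding A
      by (intro closed_vimage continuous_intros)
    have cP: "convex (P i)" using poly[OF i] polyhedron_imp_convex by blast
    show "convex (A i)"
    proof (rule convexI)
      fix s t u v :: real
      assume *: "s \<in> A i" "t \<in> A i" "0 \<le> u" "0 \<le> v" "u + v = 1"
      then have "u *\<^sub>R (x + s *\<^sub>R b) + v *\<^sub>R (x + t *\<^sub>R b) \<in> P i"
        using cP by (auto simp: A_def convex_def)
      moreover have "u *\<^sub>R (x + s *\<^sub>R b) + v *\<^sub>R (x + t *\<^sub>R b) = (u + v) *\<^sub>R x + (u * s + v * t) *\<^sub>R b"
        by (simp add: algebra_simps)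
      ultimately show "u *\<^sub>R s + v *\<^sub>R t \<in> A i" using * by (simp add: A_def)
    qed
  next
    fix t
    show "(\<Sum>i\<in>I. a i * indicator (A i) t) = 0"
      using rel[of "x + t *\<^sub>R b"] by (simp add: A_def indicator_def)
  qed
  then show ?thesis by (simp add: A_def indicator_def)
qed

lemma euler_polyhedra:
  fixes P :: "'i \<Rightarrow> 'a::euclidean_space set" and a :: "'i \<Rightarrow> int"
  assumes fin: "finite I" and poly: "\<And>i. i \<in> I \<Longrightarrow> polyhedron (P i)"
    and rel: "\<And>x. (\<Sum>i\<in>I. a i * indicator (P i) x) = 0"
  shows "(\<Sum>i\<in>I. a i * of_bool (P i \<noteq> {})) = 0"
proof -
  have "(\<forall>i\<in>I. polyhedron {x. \<exists>c. x + (\<Sum>b\<in>S. c b *\<^sub>R b) \<in> P i}) \<and>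
      (\<forall>x. (\<Sum>i\<in>I. a i * indicator {x. \<exists>c. x + (\<Sum>b\<in>S. c b *\<^sub>R b) \<in> P i} x) = 0)"
    if "finite S" for S
    using that
  proof (induction S)
    case empty
    then show ?case using poly rel by simp
  next
    case (insert b S)
    have eq: "{x. \<exists>c. x + (\<Sum>b\<in>insert b S. c b *\<^sub>R b) \<in> P i} =
        {x. \<exists>t. x + t *\<^sub>R b \<in> {x. \<exists>c. x + (\<Sum>b\<in>S. c b *\<^sub>R b) \<in> P i}}" for i
    proof (intro set_eqI iffI; clarsimp)
      fix x c assume "x + (\<Sum>b\<in>insert b S. c b *\<^sub>R b) \<in> P i"
      then show "\<exists>t c. x + t *\<^sub>R b + (\<Sum>b\<in>S. c b *\<^sub>R b) \<in> P i"
        using insert by (auto simp: add.assoc)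
    next
      fix x t c assume *: "x + t *\<^sub>R b + (\<Sum>b\<in>S. c b *\<^sub>R b) \<in> P i"
      have "(\<Sum>b'\<in>S. (c(b := t)) b' *\<^sub>R b') = (\<Sum>b\<in>S. c b *\<^sub>R b)"
        using insert by (intro sum.cong) auto
      then show "\<exists>c. x + (\<Sum>b\<in>insert b S. c b *\<^sub>R b) \<in> P i"
        using * insert by (intro exI[of _ "c(b := t)"]) (simp add: add.assoc)
    qed
    show ?case unfolding eq
    proof (intro conjI ballI allI)
      fix i assume "i \<in> I"
      then show "polyhedron {x. \<exists>t. x + t *\<^sub>R b \<in> {x. \<exists>c. x + (\<Sum>b\<in>S. c b *\<^sub>R b) \<in> P i}}"
        by (intro polyhedron_project) (use insert.IH in blast)
    next
      fix x
      show "(\<Sum>i\<in>I. a i * indicator {x. \<exists>t. x + t *\<^sub>R b \<in> {x. \<exists>c. x + (\<Sum>b\<in>S. c b *\<^sub>R b) \<in> P i}} x) = 0"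
        by (rule euler_project[OF fin]) (use insert.IH in blast)+
    qed
  qed
  from this[OF finite_Basis]
  have "(\<Sum>i\<in>I. a i * indicator {x. \<exists>c. x + (\<Sum>b\<in>Basis. c b *\<^sub>R b) \<in> P i} 0) = 0" by blast
  moreover have "(\<exists>c. 0 + (\<Sum>b\<in>Basis. c b *\<^sub>R b) \<in> P i) \<longleftrightarrow> P i \<noteq> {}" for i
  proof
    assume "P i \<noteq> {}"
    then obtain y where "y \<in> P i" by auto
    then show "\<exists>c. 0 + (\<Sum>b\<in>Basis. c b *\<^sub>R b) \<in> P i"
      by (intro exI[of _ "\<lambda>b. y \<bullet> b"]) (simp add: euclidean_representation)
  qed auto
  ultimately show ?thesis by (simp add: indicator_def)
qed

lemma polyhedron_reflect:
  fixes D :: "'a::euclidean_space set"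
  assumes "polyhedron D"
  shows "polyhedron {y. x - y \<in> D}"
proof -
  obtain F where F: "finite F" "D = \<Inter>F" "\<forall>h\<in>F. \<exists>a \<beta>. a \<noteq> 0 \<and> h = {x. a \<bullet> x \<le> \<beta>}"
    using assms unfolding polyhedron_def by auto
  then obtain a \<beta> where h: "\<And>h. h \<in> F \<Longrightarrow> h = {x. a h \<bullet> x \<le> \<beta> h}" by metis
  have "{y. x - y \<in> D} = \<Inter>((\<lambda>h. {y. (- a h) \<bullet> y \<le> \<beta> h - a h \<bullet> x}) ` F)"
  proof -
    have "z \<in> D \<longleftrightarrow> (\<forall>h\<in>F. a h \<bullet> z \<le> \<beta> h)" for z using F(2) h by blast
    then show ?thesis by (auto simp: inner_diff_right algebra_simps)
  qed
  then show ?thesis using F(1) by (auto intro!: polyhedron_Inter polyhedron_halfspace_le simp del: inner_minus_left)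
qed

definition cone_rep :: "('a::euclidean_space \<Rightarrow> int) \<Rightarrow> 'a set set \<Rightarrow> ('a set \<Rightarrow> int) \<Rightarrow> bool" where
  "cone_rep f S a \<longleftrightarrow> finite S \<and> S \<subseteq> Cones \<and> f = (\<lambda>x. \<Sum>C\<in>S. a C * indicator C x)"

lemma cone_group_rep: "f \<in> cone_group \<longleftrightarrow> (\<exists>S a. cone_rep f S a)"
  by (simp add: cone_group_def cone_rep_def)

lemma cone_rep_superset:
  assumes "cone_rep f S a" "finite T" "S \<subseteq> T" "T \<subseteq> Cones"
  shows "cone_rep f T (\<lambda>C. if C \<in> S then a C else 0)"
proof -
  have "(\<Sum>C\<in>T. (if C \<in> S then a C else 0) * g C) = (\<Sum>C\<in>S. a C * g C)" for g :: "'a set \<Rightarrow> int"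
    using assms by (intro sum.mono_neutral_cong_right) auto
  then show ?thesis using assms by (simp add: cone_rep_def)
qed

lemma cone_rep_add:
  assumes "cone_rep f S a" "cone_rep g T b"
  shows "cone_rep (\<lambda>x. f x + g x) (S \<union> T)
      (\<lambda>C. (if C \<in> S then a C else 0) + (if C \<in> T then b C else 0))"
proof -
  have ST: "finite (S \<union> T)" "S \<union> T \<subseteq> Cones" using assms by (auto simp: cone_rep_def)
  have "cone_rep f (S \<union> T) (\<lambda>C. if C \<in> S then a C else 0)"
       "cone_rep g (S \<union> T) (\<lambda>C. if C \<in> T then b C else 0)"
    by (rule cone_rep_superset[OF _ ST(1) _ ST(2)]; use assms in simp)+
  then show ?thesis by (simp add: cone_rep_def fun_eq_iff distrib_right sum.distrib)
qed

lemma sum_plus_cone_eq: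
  fixes D :: "'a::euclidean_space set"
  assumes "cone_rep f S a" "cone_rep f T b" "polyhedron D"
  shows "(\<Sum>C\<in>S. a C * indicator (C + D) x) = (\<Sum>C\<in>T. b C * indicator (C + D) x)"
proof -
  define W where "W = S \<union> T"
  define a' where "a' C = (if C \<in> S then a C else 0)" for C
  define b' where "b' C = (if C \<in> T then b C else 0)" for C
  have W: "finite W" "W \<subseteq> Cones" using assms by (auto simp: W_def cone_rep_def)
  have sa: "(\<Sum>C\<in>W. a' C * g C) = (\<Sum>C\<in>S. a C * g C)" for g
    unfolding a'_def W_def using assms by (intro sum.mono_neutral_cong_right) (auto simp: cone_rep_def)
  have sb: "(\<Sum>C\<in>W. b' C * g C) = (\<Sum>C\<in>T. b C * g C)" for g
    unfolding b'_def W_def using assms by (intro sum.mono_neutral_cong_right) (auto simp: cone_rep_def)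
  define R where "R C = C \<inter> {y. x - y \<in> D}" for C
  have "(\<Sum>C\<in>W. (a' C - b' C) * of_bool (R C \<noteq> {})) = 0"
  proof (rule euler_polyhedra[OF W(1)])
    show "polyhedron (R C)" if "C \<in> W" for C
      using that W(2) polyhedron_reflect[OF assms(3)] by (auto simp: R_def Cones_def)
  next
    fix y
    have "(\<Sum>C\<in>W. a' C * indicator C y) = f y" "(\<Sum>C\<in>W. b' C * indicator C y) = f y"
      unfolding sa sb using assms(1,2)[unfolded cone_rep_def] by metis+
    then have "(\<Sum>C\<in>W. (a' C - b' C) * indicator C y) = 0"
      by (simp add: left_diff_distrib sum_subtractf)
    then show "(\<Sum>C\<in>W. (a' C - b' C) * indicator (R C) y) = 0"
      unfolding R_def by (cases "x - y \<in> D") (simp_all add: indicator_def)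
  qed
  moreover have "of_bool (R C \<noteq> {}) = (indicator (C + D) x :: int)" for C
  proof -
    have "R C \<noteq> {} \<longleftrightarrow> x \<in> C + D"
      by (auto simp: R_def set_plus_def) (metis add_diff_cancel_left' diff_add_cancel add.commute)+
    then show ?thesis by (simp add: indicator_def)
  qed
  ultimately have "(\<Sum>C\<in>W. (a' C - b' C) * indicator (C + D) x) = 0" by simp
  then have "(\<Sum>C\<in>W. a' C * indicator (C + D) x) = (\<Sum>C\<in>W. b' C * indicator (C + D) x)"
    by (simp add: left_diff_distrib sum_subtractf)
  then show ?thesis by (simp only: sa sb)
qed

definition rep_product ::
    "'a::euclidean_space set set \<Rightarrow> ('a set \<Rightarrow> int) \<Rightarrow> 'a set set \<Rightarrow> ('a set \<Rightarrow> int) \<Rightarrow> 'a \<Rightarrow> int" where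
  "rep_product S a T b = (\<lambda>x. \<Sum>C\<in>S. \<Sum>D\<in>T. a C * b D * indicator (C + D) x)"

lemma rep_product_left:
  "rep_product S a T b x = (\<Sum>D\<in>T. b D * (\<Sum>C\<in>S. a C * indicator (C + D) x))"
  unfolding rep_product_def by (subst sum.swap) (simp add: sum_distrib_left mult_ac)

lemma rep_product_right:
  "rep_product S a T b x = (\<Sum>C\<in>S. a C * (\<Sum>D\<in>T. b D * indicator (D + C) x))"
  unfolding rep_product_def by (simp add: sum_distrib_left mult_ac add.commute)

lemma rep_product_eq:
  assumes "cone_rep f S a" "cone_rep f S' a'" "cone_rep g T b" "cone_rep g T' b'"
  shows "rep_product S a T b = rep_product S' a' T' b'"
proof
  fix x
  have T: "polyhedron D" if "D \<in> T" for D using that assms by (auto simp: cone_rep_def Cones_def)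
  have S': "polyhedron C" if "C \<in> S'" for C using that assms by (auto simp: cone_rep_def Cones_def)
  have "rep_product S a T b x = rep_product S' a' T b x"
    unfolding rep_product_left
    by (intro sum.cong refl arg_cong2[of _ _ _ _ "(*)"] sum_plus_cone_eq[OF assms(1,2)] T)
  also have "\<dots> = rep_product S' a' T' b' x"
    unfolding rep_product_right
    by (intro sum.cong refl arg_cong2[of _ _ _ _ "(*)"] sum_plus_cone_eq[OF assms(3,4)] S')
  finally show "rep_product S a T b x = rep_product S' a' T' b' x" .
qed

lemma rep_product_add_left:
  assumes "finite S" "finite S'"
  shows "rep_product (S \<union> S') (\<lambda>C. (if C \<in> S then a C else 0) + (if C \<in> S' then a' C else 0)) T b x
    = rep_product S a T b x + rep_product S' a' T b x"
proof -
  have 1: "(\<Sum>C\<in>S\<union>S'. (if C \<in> S then a C else 0) * g C) = (\<Sum>C\<in>S. a C * g C)" for g :: "_ \<Rightarrow> int"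
    using assms by (intro sum.mono_neutral_cong_right) auto
  have 2: "(\<Sum>C\<in>S\<union>S'. (if C \<in> S' then a' C else 0) * g C) = (\<Sum>C\<in>S'. a' C * g C)" for g :: "_ \<Rightarrow> int"
    using assms by (intro sum.mono_neutral_cong_right) auto
  show ?thesis
    unfolding rep_product_right distrib_right sum.distrib 1 2 ..
qed

lemma rep_product_commute: "rep_product S a T b = rep_product T b S a"
  by (rule ext) (simp only: rep_product_left[of S a T b] rep_product_right[of T b S a])

lemma is_cone_product_exists:
  "\<exists>m :: ('a::euclidean_space \<Rightarrow> int) \<Rightarrow> ('a \<Rightarrow> int) \<Rightarrow> 'a \<Rightarrow> int. is_cone_product m"
proof -
  have "\<forall>f::'a \<Rightarrow> int. \<exists>p. f \<in> cone_group \<longrightarrow> cone_rep f (fst p) (snd p)"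
    by (auto simp: cone_group_rep)
  then obtain p where p: "\<And>f::'a \<Rightarrow> int. f \<in> cone_group \<Longrightarrow> cone_rep f (fst (p f)) (snd (p f))"
    by metis
  define m where "m f g = rep_product (fst (p f)) (snd (p f)) (fst (p g)) (snd (p g))" for f g
  have m: "m f g = rep_product S a T b" if "cone_rep f S a" "cone_rep g T b" for f g S a T b
    unfolding m_def
    by (rule rep_product_eq[OF p that(1) p that(2)]) (use that in \<open>auto simp: cone_group_rep\<close>)
  have comm: "m f g = m g f" for f g
    unfolding m_def by (rule rep_product_commute)
  have add: "m (\<lambda>x. f x + g x) h = (\<lambda>x. m f h x + m g h x)"
    if "f \<in> cone_group" "g \<in> cone_group" "h \<in> cone_group" for f g h
  proof -
    obtain S a S' a' T b where r: "cone_rep f S a" "cone_rep g S' a'" "cone_rep h T b"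
      using \<open>f \<in> cone_group\<close> \<open>g \<in> cone_group\<close> \<open>h \<in> cone_group\<close> unfolding cone_group_rep by blast
    have "finite S" "finite S'" using r by (auto simp: cone_rep_def)
    then show ?thesis
      unfolding m[OF cone_rep_add[OF r(1,2)] r(3)] m[OF r(1,3)] m[OF r(2,3)]
      by (intro ext) (rule rep_product_add_left)
  qed
  have gen: "m (indicator C) (indicator D) = indicator (C + D)" if "C \<in> Cones" "D \<in> Cones" for C D
  proof -
    have "cone_rep (indicator C) {C} (\<lambda>_. 1)" "cone_rep (indicator D) {D} (\<lambda>_. 1)"
      using that by (auto simp: cone_rep_def)
    from m[OF this] show ?thesis by (simp add: rep_product_def)
  qed
  have "is_cone_product m"
    unfolding is_cone_product_def by (metis (no_types) add comm gen)
  then show ?thesis by blast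
qed

lemma is_cone_product_cone_product: "is_cone_product cone_product"
  unfolding cone_product_def by (rule someI_ex[OF is_cone_product_exists])

lemma indicator_mem_cone_group: "C \<in> Cones \<Longrightarrow> indicator C \<in> cone_group"
  unfolding cone_group_rep cone_rep_def
  by (rule exI[of _ "{C}"], rule exI[of _ "\<lambda>_. 1"]) auto

lemma add_mem_cone_group:
  "f \<in> cone_group \<Longrightarrow> g \<in> cone_group \<Longrightarrow> (\<lambda>x. f x + g x) \<in> cone_group"
  unfolding cone_group_rep using cone_rep_add by blast

lemma scale_mem_cone_group: "f \<in> cone_group \<Longrightarrow> (\<lambda>x. c * f x) \<in> cone_group"
proof -
  assume "f \<in> cone_group"
  then obtain S a where "cone_rep f S a" by (auto simp: cone_group_rep)
  then have "cone_rep (\<lambda>x. c * f x) S (\<lambda>C. c * a C)"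
    by (simp add: cone_rep_def sum_distrib_left mult.assoc)
  then show ?thesis by (auto simp: cone_group_rep)
qed

lemma zero_mem_cone_group: "(\<lambda>x. 0) \<in> cone_group"
  unfolding cone_group_rep cone_rep_def by (rule exI[of _ "{}"]) auto

lemma additive_scale:
  fixes T :: "('a::euclidean_space \<Rightarrow> int) \<Rightarrow> 'a \<Rightarrow> int"
  assumes add: "\<And>f g. f \<in> cone_group \<Longrightarrow> g \<in> cone_group \<Longrightarrow> T (\<lambda>x. f x + g x) = (\<lambda>x. T f x + T g x)"
    and f: "f \<in> cone_group"
  shows "T (\<lambda>x. c * f x) = (\<lambda>x. c * T f x)"
proof -
  have zero: "T (\<lambda>x. 0) = (\<lambda>x. 0)"
    using add[OF zero_mem_cone_group zero_mem_cone_group] by (simp add: fun_eq_iff)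
  have nat: "T (\<lambda>x. int n * f x) = (\<lambda>x. int n * T f x)" for n
  proof (induction n)
    case (Suc n)
    have "T (\<lambda>x. int n * f x + f x) = (\<lambda>x. T (\<lambda>x. int n * f x) x + T f x)"
      by (intro add f scale_mem_cone_group)
    then show ?case by (simp add: Suc.IH distrib_right add.commute)
  qed (simp add: zero)
  show ?thesis
  proof (cases "c \<ge> 0")
    case True
    then show ?thesis using nat[of "nat c"] by simp
  next
    case False
    have "T (\<lambda>x. c * f x + int (nat (- c)) * f x) = (\<lambda>x. T (\<lambda>x. c * f x) x + T (\<lambda>x. int (nat (- c)) * f x) x)"
      by (intro add f scale_mem_cone_group)
    moreover have "T (\<lambda>x. (- c) * f x) = (\<lambda>x. (- c) * T f x)"
      using nat[of "nat (- c)"] False by simp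
    ultimately show ?thesis using False by (simp add: zero fun_eq_iff)
  qed
qed

lemma additive_eqI:
  fixes T T' :: "('a::euclidean_space \<Rightarrow> int) \<Rightarrow> 'a \<Rightarrow> int"
  assumes add: "\<And>f g. f \<in> cone_group \<Longrightarrow> g \<in> cone_group \<Longrightarrow> T (\<lambda>x. f x + g x) = (\<lambda>x. T f x + T g x)"
    and add': "\<And>f g. f \<in> cone_group \<Longrightarrow> g \<in> cone_group \<Longrightarrow> T' (\<lambda>x. f x + g x) = (\<lambda>x. T' f x + T' g x)"
    and gen: "\<And>C. C \<in> Cones \<Longrightarrow> T (indicator C) = T' (indicator C)"
    and f: "f \<in> cone_group"
  shows "T f = T' f"
proof -
  have "T (\<lambda>x. \<Sum>C\<in>S. a C * indicator C x) = T' (\<lambda>x. \<Sum>C\<in>S. a C * indicator C x)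
      \<and> (\<lambda>x. \<Sum>C\<in>S. a C * indicator C x) \<in> cone_group"
    if "finite S" "S \<subseteq> Cones" for S and a :: "'a set \<Rightarrow> int"
    using that
  proof (induction S)
    case empty
    have "T (\<lambda>x. 0) = (\<lambda>x. 0)" "T' (\<lambda>x. 0) = (\<lambda>x. 0)"
      using add[OF zero_mem_cone_group zero_mem_cone_group]
        add'[OF zero_mem_cone_group zero_mem_cone_group] by (simp_all add: fun_eq_iff)
    then show ?case by (simp add: zero_mem_cone_group)
  next
    case (insert C S)
    then have C: "indicator C \<in> cone_group" "C \<in> Cones" by (auto intro: indicator_mem_cone_group)
    have aC: "(\<lambda>x. a C * indicator C x) \<in> cone_group" by (intro scale_mem_cone_group C)
    have IH: "T (\<lambda>x. \<Sum>C\<in>S. a C * indicator C x) = T' (\<lambda>x. \<Sum>C\<in>S. a C * indicator C x)"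
      "(\<lambda>x. \<Sum>C\<in>S. a C * indicator C x) \<in> cone_group" using insert by auto
    have eq: "(\<lambda>x. \<Sum>C\<in>insert C S. a C * indicator C x) =
        (\<lambda>x. a C * indicator C x + (\<Sum>C\<in>S. a C * indicator C x))" using insert by auto
    have sc: "T (\<lambda>x. a C * indicator C x) = (\<lambda>x. a C * T (indicator C) x)"
      by (rule additive_scale[OF _ C(1)]) (rule add)
    have sc': "T' (\<lambda>x. a C * indicator C x) = (\<lambda>x. a C * T' (indicator C) x)"
      by (rule additive_scale[OF _ C(1)]) (rule add')
    show ?case
      using add[OF aC IH(2)] add'[OF aC IH(2)] add_mem_cone_group[OF aC IH(2)]
      unfolding eq sc sc' gen[OF C(2)] IH(1) by (intro conjI) (simp only:, assumption)
  qed
  then show ?thesis using f by (auto simp: cone_group_def)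
qed

lemma is_cone_productD:
  assumes "is_cone_product m"
  shows "f \<in> cone_group \<Longrightarrow> g \<in> cone_group \<Longrightarrow> h \<in> cone_group \<Longrightarrow>
      m (\<lambda>x. f x + g x) h = (\<lambda>x. m f h x + m g h x)"
    and "f \<in> cone_group \<Longrightarrow> g \<in> cone_group \<Longrightarrow> h \<in> cone_group \<Longrightarrow>
      m h (\<lambda>x. f x + g x) = (\<lambda>x. m h f x + m h g x)"
    and "C \<in> Cones \<Longrightarrow> D \<in> Cones \<Longrightarrow> m (indicator C) (indicator D) = indicator (C + D)"
  using assms unfolding is_cone_product_def by blast+

lemma is_cone_product_unique:
  assumes m: "is_cone_product m" and m': "is_cone_product m'"
    and f: "f \<in> cone_group" and g: "g \<in> cone_group"
  shows "m f g = m' f g"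
proof (rule additive_eqI[where f = f and T = "\<lambda>f. m f g" and T' = "\<lambda>f. m' f g"])
  fix C :: "'a set" assume C: "C \<in> Cones"
  show "m (indicator C) g = m' (indicator C) g"
  proof (rule additive_eqI[where f = g and T = "m (indicator C)" and T' = "m' (indicator C)"])
    fix D :: "'a set" assume "D \<in> Cones"
    then show "m (indicator C) (indicator D) = m' (indicator C) (indicator D)"
      by (simp only: is_cone_productD(3)[OF m C] is_cone_productD(3)[OF m' C])
  qed (rule is_cone_productD(2)[OF m] is_cone_productD(2)[OF m'] g; (assumption | rule indicator_mem_cone_group[OF C]))+
qed (rule is_cone_productD(1)[OF m] is_cone_productD(1)[OF m'] f; (assumption | rule g))+

declare sum_mult_indicator [simp] sum_indicator_mult [simp]

end

theory Submission
  imports Defs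
begin

text \<open>
  Choose a normal vector in \<open>U\<close> for each hyperplane and let \<open>N\<close> be the set of these normals. A chamber
  is then the set of points of \<open>U\<close> with a fixed realizable sign pattern on \<open>N\<close> (a tope), and the
  identity is checked pointwise, by counting.

  Let \<open>C\<close> be a chamber closure with sign pattern \<open>P\<close>, let \<open>L\<close> be a flat, and let \<open>Z \<subseteq> N\<close> be the
  normals that vanish on \<open>L\<close>. The faces of \<open>C\<close> are the sets \<open>C \<inter> L\<close>, once for each flat \<open>L\<close> that they
  span. Such a face is a chamber closure of the arrangement that the normals outside \<open>Z\<close> cut out on
  \<open>L\<close>, and the normal cone at it is the polar of a chamber closure of the arrangement with normals
  \<open>Z\<close> in \<open>U\<close> (\<open>normal_cone_flat_face\<close>). Conversely every pair consisting of a chamber of the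
  restriction to \<open>L\<close> and a chamber of the localization at \<open>L\<close> comes from exactly one \<open>P\<close>
  (\<open>topes_decompose\<close>). Write the point of evaluation as \<open>y + z\<close> with \<open>y \<in> L\<close> and \<open>z \<in> L\<^sup>\<bottom>\<close>. As faces
  lie in \<open>L\<close> and normal cones in \<open>L\<^sup>\<bottom>\<close>, the contribution of \<open>L\<close> is a product of two counts: the
  closed chambers of the restriction that contain \<open>y\<close>, and the closed chambers of the localization on
  which the inner product with \<open>z\<close> is nonpositive. On the other side the cone product
  \<open>[K] \<star> [M\<^sup>\<bottom>] = [K + M\<^sup>\<bottom>]\<close> with \<open>K \<subseteq> L \<subseteq> M\<close> splits in the same way.

  Both counts follow from a single theorem in the style of Zaslavsky, \<open>sum_topes_eq_whitney_sum\<close>.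
  For each of them the summand \<open>v\<close> satisfies
  \<open>v (C \<inter> {a \<ge> 0}) + v (C \<inter> {a \<le> 0}) = v C + v (C \<inter> {a = 0})\<close> on convex sets; for the polar this is the
  observation that a segment joining two points where \<open>z\<close> is positive, on different sides of the
  hyperplane, meets the hyperplane at a point where \<open>z\<close> is positive. Deletion and restriction then
  turn the sum of \<open>v\<close> over the chambers of \<open>V\<close> into a signed sum of \<open>v\<close> over the intersections of
  \<open>V\<close> with sets of hyperplanes. Grouping that sum by flats gives Moebius values
  (\<open>mobius_eq_sum\<close>). The same recursion shows that the grouped coefficients are
  nonnegative, hence that they are the absolute values \<open>\<bar>\<mu>\<bar>\<close>.
\<close>

section \<open>Zero loci and signed sums over subsets\<close>

definition zero_locus :: "'a::euclidean_space set \<Rightarrow> 'a set \<Rightarrow> 'a set" where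
  "zero_locus V B = {x \<in> V. \<forall>a\<in>B. a \<bullet> x = 0}"

lemma zero_locus_empty [simp]: "zero_locus V {} = V"
  by (simp add: zero_locus_def)

lemma zero_locus_zero_locus [simp]: "zero_locus (zero_locus V A) B = zero_locus V (A \<union> B)"
  by (auto simp: zero_locus_def)

lemma subspace_zero_locus: "subspace V \<Longrightarrow> subspace (zero_locus V B)"
  by (auto simp: subspace_def zero_locus_def inner_add_right)

lemma zero_locus_redundant: "\<forall>x\<in>V. a \<bullet> x = 0 \<Longrightarrow> zero_locus V (insert a B) = zero_locus V B"
  by (auto simp: zero_locus_def)

lemma dim_zero_locus:
  assumes V: "subspace V" and x: "x \<in> V" "a \<bullet> x \<noteq> 0"
  shows "dim V = dim (zero_locus V {a}) + 1"
proof -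
  let ?H = "zero_locus V {a}"
  have H: "subspace ?H" using V by (rule subspace_zero_locus)
  have "V \<subseteq> span (insert x ?H)"
  proof
    fix y assume y: "y \<in> V"
    let ?c = "(a \<bullet> y) / (a \<bullet> x)"
    have "y - ?c *\<^sub>R x \<in> ?H"
      using V x y by (auto simp: zero_locus_def inner_diff_right subspace_diff subspace_scale)
    then show "y \<in> span (insert x ?H)"
      unfolding span_insert using span_base by auto
  qed
  moreover have "insert x ?H \<subseteq> V" using x by (auto simp: zero_locus_def)
  ultimately have "dim V = dim (insert x ?H)"
    by (metis dim_span dim_subset le_antisym)
  moreover have "x \<notin> span ?H"
    using H x by (simp add: span_eq_iff[THEN iffD2]) (simp add: zero_locus_def)
  ultimately show ?thesis by (simp add: dim_insert)
qed

text \<open>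
  Whitney's signed count of subsets of hyperplanes, with a weight \<open>v\<close> on the intersections. The exponent has the parity of \<open>card B\<close> plus the
  codimension of the intersection in \<open>V\<close>; with \<open>v = 1\<close> the sum is the number of chambers.
\<close>

definition whitney_sum :: "'a::euclidean_space set \<Rightarrow> 'a set \<Rightarrow> ('a set \<Rightarrow> int) \<Rightarrow> int" where
  "whitney_sum V I v =
     (\<Sum>B\<in>Pow I. (-1) ^ (card B + dim V + dim (zero_locus V B)) * v (zero_locus V B))"

lemma sum_Pow_insert:
  fixes f :: "'b set \<Rightarrow> 'c::comm_monoid_add"
  assumes "finite I" "a \<notin> I"
  shows "sum f (Pow (insert a I)) = (\<Sum>P\<in>Pow I. f P + f (insert a P))"
proof -
  have "inj_on (insert a) (Pow I)" using assms by (fastforce simp: inj_on_def)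
  then have "sum f (insert a ` Pow I) = (\<Sum>P\<in>Pow I. f (insert a P))"
    by (simp add: sum.reindex)
  moreover have "Pow I \<inter> insert a ` Pow I = {}" using assms by auto
  ultimately show ?thesis
    using assms by (simp add: Pow_insert sum.union_disjoint sum.distrib)
qed

text \<open>
  Subsets with and without \<open>a\<close> are separated. Adding \<open>a\<close> to \<open>B\<close> changes the parity of the
  cardinality, and replacing \<open>V\<close> by the hyperplane \<open>a = 0\<close> changes that of \<open>dim V\<close>, so both
  parts carry a plus sign.
\<close>

lemma whitney_sum_insert:
  assumes V: "subspace V" and I: "finite I" "a \<notin> I" and x: "x \<in> V" "a \<bullet> x \<noteq> 0"
  shows "whitney_sum V (insert a I) v = whitney_sum V I v + whitney_sum (zero_locus V {a}) I v"
proof -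
  have "card (insert a B) = card B + 1" if "B \<subseteq> I" for B
    using that I by (metis Suc_eq_plus1 card_insert_disjoint finite_subset subsetD)
  then show ?thesis
    unfolding whitney_sum_def sum_Pow_insert[OF I] sum.distrib[symmetric]
    by (intro sum.cong) (auto simp: dim_zero_locus[OF V x])
qed

text \<open>
  Here \<open>B\<close> and \<open>insert a B\<close> cut out the same space and cancel. This matches the
  absence of chambers when one of the forms vanishes identically.
\<close>

lemma whitney_sum_insert_redundant:
  assumes I: "finite I" "a \<notin> I" and a: "\<forall>x\<in>V. a \<bullet> x = 0"
  shows "whitney_sum V (insert a I) v = 0"
proof -
  have "card (insert a B) = card B + 1" if "B \<subseteq> I" for B
    using that I by (metis Suc_eq_plus1 card_insert_disjoint finite_subset subsetD)
  then show ?thesis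
    unfolding whitney_sum_def sum_Pow_insert[OF I]
    by (intro sum.neutral) (auto simp: zero_locus_redundant[OF a])
qed

text \<open>
  The recursion has no minus signs. This is what later identifies the coefficients with
  absolute values of the Moebius function.
\<close>

lemma whitney_sum_nonneg:
  assumes "subspace V" "finite I" "\<And>X. v X \<ge> 0"
  shows "whitney_sum V I v \<ge> 0"
  using assms(2,1)
proof (induction I arbitrary: V)
  case empty
  show ?case using assms(3) by (simp add: whitney_sum_def)
next
  case (insert a I)
  show ?case
  proof (cases "\<forall>x\<in>V. a \<bullet> x = 0")
    case True
    then show ?thesis using insert by (simp add: whitney_sum_insert_redundant)
  next
    case False
    then obtain x where "x \<in> V" "a \<bullet> x \<noteq> 0" by auto
    then show ?thesis
      using insert by (simp add: whitney_sum_insert[OF insert.prems insert.hyps] subspace_zero_locus)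
  qed
qed

section \<open>Cells\<close>

text \<open>
  The set \<open>P\<close> records which of the forms in \<open>I\<close> are positive; only \<open>P \<inter> I\<close> matters.
\<close>

definition open_cell :: "'a::euclidean_space set \<Rightarrow> 'a set \<Rightarrow> 'a set \<Rightarrow> 'a set" where
  "open_cell V I P = {x \<in> V. \<forall>a\<in>I. if a \<in> P then a \<bullet> x > 0 else a \<bullet> x < 0}"

definition closed_cell :: "'a::euclidean_space set \<Rightarrow> 'a set \<Rightarrow> 'a set \<Rightarrow> 'a set" where
  "closed_cell V I P = {x \<in> V. \<forall>a\<in>I. if a \<in> P then a \<bullet> x \<ge> 0 else a \<bullet> x \<le> 0}"

definition topes :: "'a::euclidean_space set \<Rightarrow> 'a set \<Rightarrow> 'a set set" where
  "topes V I = {P. P \<subseteq> I \<and> open_cell V I P \<noteq> {}}"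

lemma finite_topes: "finite I \<Longrightarrow> finite (topes V I)"
  by (rule finite_subset[of _ "Pow I"]) (auto simp: topes_def)

lemma convex_open_cell:
  assumes "subspace V" shows "convex (open_cell V I P)"
proof -
  have "open_cell V I P = V \<inter> (\<Inter>a\<in>I. if a \<in> P then {x. a \<bullet> x > 0} else {x. a \<bullet> x < 0})"
    by (auto simp: open_cell_def split: if_splits)
  moreover have "convex (if a \<in> P then {x. a \<bullet> x > 0} else {x. a \<bullet> x < 0})" for a
    by (simp add: convex_halfspace_gt convex_halfspace_lt)
  ultimately show ?thesis
    using subspace_imp_convex[OF assms] by (simp only:) (intro convex_Int convex_INT)
qed

lemma closed_cell_eq:
  "closed_cell V I P = V \<inter> (\<Inter>a\<in>I. if a \<in> P then {x. a \<bullet> x \<ge> 0} else {x. a \<bullet> x \<le> 0})"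
  by (auto simp: closed_cell_def split: if_splits)

lemma convex_closed_cell:
  assumes "subspace V" shows "convex (closed_cell V I P)"
proof -
  have "convex (if a \<in> P then {x. a \<bullet> x \<ge> 0} else {x. a \<bullet> x \<le> 0})" for a
    by (simp add: convex_halfspace_ge convex_halfspace_le)
  then show ?thesis
    unfolding closed_cell_eq using subspace_imp_convex[OF assms] by (intro convex_Int convex_INT)
qed

lemma closed_closed_cell:
  assumes "subspace V" shows "closed (closed_cell V I P)"
proof -
  have "closed (if a \<in> P then {x. a \<bullet> x \<ge> 0} else {x. a \<bullet> x \<le> 0})" for a
    by (simp add: closed_halfspace_ge closed_halfspace_le)
  then show ?thesis
    unfolding closed_cell_eq using closed_subspace[OF assms] by (intro closed_Int closed_INT ballI)
qed

lemma open_cell_subset_closed_cell: "open_cell V I P \<subseteq> closed_cell V I P"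
  by (auto simp: open_cell_def closed_cell_def split: if_splits)

lemma closed_cell_scale:
  assumes "subspace V" "x \<in> closed_cell V I P" "c \<ge> 0" shows "c *\<^sub>R x \<in> closed_cell V I P"
  using assms by (auto simp: closed_cell_def subspace_scale mult_nonneg_nonneg mult_nonneg_nonpos)

lemma zero_in_closed_cell: "subspace V \<Longrightarrow> 0 \<in> closed_cell V I P"
  by (simp add: closed_cell_def subspace_0)

lemma closed_cell_add_open_cell:
  assumes "subspace V" "x \<in> closed_cell V I P" "p \<in> open_cell V I P" "e > 0"
  shows "x + e *\<^sub>R p \<in> open_cell V I P"
  using assms
  by (auto simp: closed_cell_def open_cell_def subspace_add subspace_scale inner_add_right
      mult_pos_neg add_nonneg_pos add_nonpos_neg split: if_splits)

lemma open_cell_nonzero: "p \<in> open_cell V I P \<Longrightarrow> a \<in> I \<Longrightarrow> a \<bullet> p \<noteq> 0"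
  by (auto simp: open_cell_def) (metis less_irrefl)

text \<open>
  Moving from \<open>q\<close> slightly in any direction keeps the signs of finitely many forms that do not vanish
  at \<open>q\<close>.
\<close>

lemma small_perturbation:
  fixes q r :: "'a::euclidean_space"
  assumes "finite J" "\<And>a. a \<in> J \<Longrightarrow> a \<bullet> q \<noteq> 0"
  obtains e where "e > 0" "\<forall>a\<in>J. sgn (a \<bullet> (q + e *\<^sub>R r)) = sgn (a \<bullet> q)"
proof -
  have "eventually (\<lambda>e. sgn (a \<bullet> (q + e *\<^sub>R r)) = sgn (a \<bullet> q)) (at_right 0)" if "a \<in> J" for a
  proof -
    have lim: "((\<lambda>e. a \<bullet> (q + e *\<^sub>R r)) \<longlongrightarrow> a \<bullet> (q + 0 *\<^sub>R r)) (at_right 0)"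
      by (intro tendsto_intros)
    have "a \<bullet> q \<noteq> 0" by (rule assms(2)[OF that])
    then consider "a \<bullet> q > 0" | "a \<bullet> q < 0" by linarith
    then show ?thesis
    proof cases
      case 1
      with order_tendstoD(1)[OF lim, of 0] show ?thesis by (auto elim!: eventually_mono)
    next
      case 2
      with order_tendstoD(2)[OF lim, of 0] show ?thesis by (auto elim!: eventually_mono)
    qed
  qed
  then have "eventually (\<lambda>e. \<forall>a\<in>J. sgn (a \<bullet> (q + e *\<^sub>R r)) = sgn (a \<bullet> q)) (at_right 0)"
    by (simp add: eventually_ball_finite_distrib assms(1))
  then have "eventually (\<lambda>e. e > 0 \<and> (\<forall>a\<in>J. sgn (a \<bullet> (q + e *\<^sub>R r)) = sgn (a \<bullet> q))) (at_right (0::real))"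
    using eventually_at_right_less by (rule eventually_conj[rotated])
  then show ?thesis
    using eventually_happens[of _ "at_right (0::real)"] that by fastforce
qed

lemma open_cell_perturb:
  assumes "subspace V" "finite I" "p \<in> open_cell V I P" "x \<in> V"
  obtains e where "e > 0" "p + e *\<^sub>R x \<in> open_cell V I P"
proof -
  obtain e where e: "e > 0" "\<forall>a\<in>I. sgn (a \<bullet> (p + e *\<^sub>R x)) = sgn (a \<bullet> p)"
    using small_perturbation[OF assms(2) open_cell_nonzero[OF assms(3)], where r = x] .
  have "a \<bullet> (p + e *\<^sub>R x) > 0 \<longleftrightarrow> a \<bullet> p > 0" "a \<bullet> (p + e *\<^sub>R x) < 0 \<longleftrightarrow> a \<bullet> p < 0" if "a \<in> I" for a
    using e(2) that by (metis sgn_1_pos, metis sgn_1_neg)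
  then have "p + e *\<^sub>R x \<in> open_cell V I P"
    using assms by (auto simp: open_cell_def subspace_add subspace_scale)
  with e(1) show ?thesis by (rule that)
qed

lemma closure_open_cell:
  assumes V: "subspace V" and p: "p \<in> open_cell V I P"
  shows "closure (open_cell V I P) = closed_cell V I P"
proof
  show "closure (open_cell V I P) \<subseteq> closed_cell V I P"
    by (intro closure_minimal open_cell_subset_closed_cell closed_closed_cell V)
  show "closed_cell V I P \<subseteq> closure (open_cell V I P)"
  proof
    fix x assume x: "x \<in> closed_cell V I P"
    have "((\<lambda>e. x + e *\<^sub>R p) \<longlongrightarrow> x + 0 *\<^sub>R p) (at_right 0)" by (intro tendsto_intros)
    moreover have "eventually (\<lambda>e. x + e *\<^sub>R p \<in> closure (open_cell V I P)) (at_right 0)"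
      using eventually_at_right_less
      by (rule eventually_mono) (use closed_cell_add_open_cell[OF V x p] closure_subset in blast)
    ultimately show "x \<in> closure (open_cell V I P)"
      by (intro Lim_in_closed_set[of _ _ "at_right (0::real)"]) auto
  qed
qed

lemma span_closed_cell:
  assumes V: "subspace V" "finite I" and p: "p \<in> open_cell V I P"
  shows "span (closed_cell V I P) = V"
proof
  show "span (closed_cell V I P) \<subseteq> V"
    using V by (intro span_minimal) (auto simp: closed_cell_def)
  show "V \<subseteq> span (closed_cell V I P)"
  proof
    fix x assume "x \<in> V"
    then obtain e where e: "e > 0" "p + e *\<^sub>R x \<in> open_cell V I P"
      using open_cell_perturb[OF V p] by blast
    then have "(1 / e) *\<^sub>R ((p + e *\<^sub>R x) - p) \<in> span (closed_cell V I P)"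
      using p open_cell_subset_closed_cell by (intro span_scale span_diff span_base) blast+
    then show "x \<in> span (closed_cell V I P)" using e by simp
  qed
qed

lemma inj_on_closed_cell: "inj_on (closed_cell V I) (topes V I)"
proof (rule inj_onI)
  fix P Q assume P: "P \<in> topes V I" and Q: "Q \<in> topes V I" and eq: "closed_cell V I P = closed_cell V I Q"
  then obtain p where p: "p \<in> open_cell V I P" by (auto simp: topes_def)
  then have "p \<in> closed_cell V I Q" using open_cell_subset_closed_cell eq by blast
  with p have "a \<in> P \<longleftrightarrow> a \<in> Q" if "a \<in> I" for a
    using that by (fastforce simp: open_cell_def closed_cell_def split: if_splits)
  then show "P = Q" using P Q by (auto simp: topes_def)
qed

section \<open>Summing a valuation over the chambers\<close>

definition splits_along_hyperplanes :: "('a::euclidean_space set \<Rightarrow> int) \<Rightarrow> bool" where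
  "splits_along_hyperplanes v \<longleftrightarrow> (\<forall>C a. convex C \<longrightarrow>
     v (C \<inter> {x. a \<bullet> x \<ge> 0}) + v (C \<inter> {x. a \<bullet> x \<le> 0}) = v C + v (C \<inter> {x. a \<bullet> x = 0}))"

lemma segment_meets_hyperplane:
  fixes p q :: "'a::euclidean_space"
  assumes "(a \<bullet> p) * (a \<bullet> q) \<le> 0"
  obtains u where "0 \<le> u" "u \<le> 1" "a \<bullet> ((1 - u) *\<^sub>R p + u *\<^sub>R q) = 0"
proof (cases "a \<bullet> p = a \<bullet> q")
  case True
  then have "a \<bullet> p = 0" using assms by (auto simp: mult_le_0_iff)
  then show ?thesis using that[of 0] by simp
next
  case False
  let ?u = "a \<bullet> p / (a \<bullet> p - a \<bullet> q)"
  have "a \<bullet> ((1 - ?u) *\<^sub>R p + ?u *\<^sub>R q) = 0"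
  proof -
    have "(1 - c) * s + c * t = s - c * (s - t)" for c s t :: real
      by (simp add: algebra_simps)
    from this[of ?u "a \<bullet> p" "a \<bullet> q"]
    have "(1 - ?u) * (a \<bullet> p) + ?u * (a \<bullet> q) = a \<bullet> p - ?u * (a \<bullet> p - a \<bullet> q)" .
    then show ?thesis using False by (simp add: inner_add_right)
  qed
  moreover have "0 \<le> ?u" "?u \<le> 1"
    using assms False by (auto simp: mult_le_0_iff divide_le_eq_1 zero_le_divide_iff)
  ultimately show ?thesis using that by blast
qed

text \<open>
  One step of deletion and restriction, for a single sign pattern. If the open cell meets the
  hyperplane, it has points on both sides, because \<open>a\<close> does not vanish on \<open>V\<close>, and the hypothesis on \<open>v\<close> applies.
  If it misses the hyperplane, it lies on one side by convexity, its closure lies on that closed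
  side, and exactly one of the two refined patterns is realized, with the same closed cell.
\<close>

lemma tope_split:
  assumes v: "splits_along_hyperplanes v" and V: "subspace V" and I: "finite I" "a \<notin> I" "P \<subseteq> I"
    and x: "x \<in> V" "a \<bullet> x \<noteq> 0"
  defines "g \<equiv> \<lambda>W J Q. if open_cell W J Q \<noteq> {} then v (closed_cell W J Q) else 0"
  shows "g V (insert a I) P + g V (insert a I) (insert a P) = g V I P + g (zero_locus V {a}) I P"
proof -
  let ?O = "open_cell V I P" and ?C = "closed_cell V I P"
  have aP: "a \<notin> P" using I by auto
  have O: "open_cell V (insert a I) P = ?O \<inter> {x. a \<bullet> x < 0}"
    "open_cell V (insert a I) (insert a P) = ?O \<inter> {x. a \<bullet> x > 0}"
    "open_cell (zero_locus V {a}) I P = ?O \<inter> {x. a \<bullet> x = 0}"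
    using aP I by (auto simp: open_cell_def zero_locus_def)
  have C: "closed_cell V (insert a I) P = ?C \<inter> {x. a \<bullet> x \<le> 0}"
    "closed_cell V (insert a I) (insert a P) = ?C \<inter> {x. a \<bullet> x \<ge> 0}"
    "closed_cell (zero_locus V {a}) I P = ?C \<inter> {x. a \<bullet> x = 0}"
    using aP I by (auto simp: closed_cell_def zero_locus_def)
  have split: "v (?C \<inter> {x. a \<bullet> x \<ge> 0}) + v (?C \<inter> {x. a \<bullet> x \<le> 0}) = v ?C + v (?C \<inter> {x. a \<bullet> x = 0})"
    using v convex_closed_cell[OF V] by (auto simp: splits_along_hyperplanes_def)
  show ?thesis
  proof (cases "?O \<inter> {x. a \<bullet> x = 0} = {}")
    case False
    then obtain p where p: "p \<in> ?O" "a \<bullet> p = 0" by auto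
    obtain e where e: "e > 0" "p + e *\<^sub>R x \<in> ?O" using open_cell_perturb[OF V I(1) p(1) x(1)] .
    obtain d where d: "d > 0" "p + d *\<^sub>R (- x) \<in> ?O"
      using open_cell_perturb[OF V I(1) p(1), of "- x"] x V by (auto simp: subspace_neg)
    have "?O \<inter> {x. a \<bullet> x > 0} \<noteq> {} \<and> ?O \<inter> {x. a \<bullet> x < 0} \<noteq> {}"
    proof (cases "a \<bullet> x > 0")
      case True
      then have "a \<bullet> (p + e *\<^sub>R x) > 0" "a \<bullet> (p + d *\<^sub>R (- x)) < 0"
        using p e d by (simp_all add: inner_add_right inner_diff_right)
      with e d show ?thesis by blast
    next
      case False
      then have "a \<bullet> x < 0" using x by linarith
      then have "a \<bullet> (p + e *\<^sub>R x) < 0" "a \<bullet> (p + d *\<^sub>R (- x)) > 0"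
        using p e d by (simp_all add: inner_add_right inner_diff_right mult_pos_neg)
      with e d show ?thesis by blast
    qed
    then show ?thesis using split False p unfolding g_def O C by auto
  next
    case no_zero: True
    show ?thesis
    proof (cases "?O = {}")
      case True
      then show ?thesis unfolding g_def O C by auto
    next
      case False
      then obtain p where p: "p \<in> ?O" by auto
      have one_side: "a \<bullet> p * (a \<bullet> q) > 0" if q: "q \<in> ?O" for q
      proof (rule ccontr)
        assume "\<not> a \<bullet> p * (a \<bullet> q) > 0"
        then have "(a \<bullet> p) * (a \<bullet> q) \<le> 0" by simp
        then obtain u where u: "0 \<le> u" "u \<le> 1" "a \<bullet> ((1 - u) *\<^sub>R p + u *\<^sub>R q) = 0"
          by (rule segment_meets_hyperplane)
        moreover have "(1 - u) *\<^sub>R p + u *\<^sub>R q \<in> ?O"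
          using convex_open_cell[OF V] p q u by (simp add: convex_alt)
        ultimately show False using no_zero by auto
      qed
      \<comment> \<open>\<open>y\<close> is the limit of the points \<open>y + e *\<^sub>R p\<close>, which lie in the open cell\<close>
      have closed_side: "a \<bullet> p * (a \<bullet> y) \<ge> 0" if y: "y \<in> ?C" for y
      proof -
        have "((\<lambda>e. a \<bullet> p * (a \<bullet> (y + e *\<^sub>R p))) \<longlongrightarrow> a \<bullet> p * (a \<bullet> (y + 0 *\<^sub>R p))) (at_right 0)"
          by (intro tendsto_intros)
        moreover have "eventually (\<lambda>e. a \<bullet> p * (a \<bullet> (y + e *\<^sub>R p)) \<ge> 0) (at_right 0)"
          using eventually_at_right_less
          by (rule eventually_mono) (use one_side closed_cell_add_open_cell[OF V y p] in \<open>force intro: less_imp_le\<close>)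
        ultimately show ?thesis
          using tendsto_lowerbound[of _ _ "at_right (0::real)"] by fastforce
      qed
      have "a \<bullet> p \<noteq> 0" using no_zero p by auto
      then consider "a \<bullet> p > 0" | "a \<bullet> p < 0" by linarith
      then show ?thesis
      proof cases
        case 1
        have "?C \<inter> {x. a \<bullet> x \<ge> 0} = ?C" using closed_side 1 by (auto simp: zero_le_mult_iff)
        moreover have "?O \<inter> {x. a \<bullet> x < 0} = {}" "?O \<inter> {x. a \<bullet> x > 0} \<noteq> {}"
          using one_side 1 p by (auto simp: zero_less_mult_iff) (metis less_asym)
        ultimately show ?thesis using no_zero False unfolding g_def O C by simp
      next
        case 2
        have "?C \<inter> {x. a \<bullet> x \<le> 0} = ?C" using closed_side 2 by (auto simp: zero_le_mult_iff)
        moreover have "?O \<inter> {x. a \<bullet> x > 0} = {}" "?O \<inter> {x. a \<bullet> x < 0} \<noteq> {}"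
          using one_side 2 p by (auto simp: zero_less_mult_iff) (metis less_asym)
        ultimately show ?thesis using no_zero False unfolding g_def O C by simp
      qed
    qed
  qed
qed

text \<open>
  Both sides satisfy the same recursion when a form is added. The subspace has to be arbitrary in the
  induction, since restriction replaces it by a hyperplane.
\<close>

lemma sum_topes_eq_whitney_sum:
  assumes v: "splits_along_hyperplanes v" and "finite I" "subspace V"
  shows "(\<Sum>P\<in>topes V I. v (closed_cell V I P)) = whitney_sum V I v"
  using assms(2,3)
proof (induction I arbitrary: V)
  case empty
  have "topes V {} = {{}}" using empty subspace_0 by (auto simp: topes_def open_cell_def)
  then show ?case by (simp add: whitney_sum_def closed_cell_def)
next
  case (insert a I)
  define g where "g W J Q = (if open_cell W J Q \<noteq> {} then v (closed_cell W J Q) else 0)" for W J Q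
  have sum_g: "(\<Sum>P\<in>topes W J. v (closed_cell W J P)) = sum (g W J) (Pow J)" if "finite J" for W J
    using that unfolding g_def topes_def
    by (subst sum.inter_filter[symmetric]) (auto intro!: sum.cong)
  show ?case
  proof (cases "\<forall>x\<in>V. a \<bullet> x = 0")
    case True
    then have "topes V (insert a I) = {}" by (force simp: topes_def open_cell_def)
    then show ?thesis using True insert by (simp add: whitney_sum_insert_redundant)
  next
    case False
    then obtain x where x: "x \<in> V" "a \<bullet> x \<noteq> 0" by auto
    have "sum (g V (insert a I)) (Pow (insert a I)) = (\<Sum>P\<in>Pow I. g V I P + g (zero_locus V {a}) I P)"
      unfolding sum_Pow_insert[OF insert.hyps] g_def
      by (intro sum.cong refl tope_split[OF v insert.prems insert.hyps _ x]) auto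
    also have "\<dots> = whitney_sum V I v + whitney_sum (zero_locus V {a}) I v"
      using insert.IH[OF insert.prems] insert.IH[OF subspace_zero_locus[OF insert.prems]]
      by (simp add: sum.distrib sum_g insert.hyps)
    also have "\<dots> = whitney_sum V (insert a I) v"
      by (rule whitney_sum_insert[OF insert.prems insert.hyps x, symmetric])
    finally show ?thesis using insert.hyps by (simp add: sum_g)
  qed
qed

definition polar :: "'a::euclidean_space set \<Rightarrow> 'a set" where
  "polar S = {c. \<forall>x\<in>S. c \<bullet> x \<le> 0}"

lemma splits_membership: "splits_along_hyperplanes (\<lambda>C. indicator C y)"
  by (auto simp: splits_along_hyperplanes_def indicator_def)

text \<open>
  The nontrivial point is that a linear form \<open>y\<close> that is nonpositive on \<open>C \<inter> {a = 0}\<close> is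
  nonpositive on one of the two halves of \<open>C\<close>. Otherwise \<open>y\<close> is positive at points \<open>p\<close> and \<open>q\<close> of
  the two halves, hence on the whole segment between them, which meets \<open>{a = 0}\<close> inside \<open>C\<close>.
\<close>

lemma splits_polar: "splits_along_hyperplanes (\<lambda>C. indicator (polar C) y)"
  unfolding splits_along_hyperplanes_def
proof (intro allI impI)
  fix C :: "'a set" and a assume C: "convex C"
  let ?P = "C \<inter> {x. a \<bullet> x \<ge> 0}" and ?N = "C \<inter> {x. a \<bullet> x \<le> 0}" and ?Z = "C \<inter> {x. a \<bullet> x = 0}"
  have "y \<in> polar C \<longleftrightarrow> y \<in> polar ?P \<and> y \<in> polar ?N"
    unfolding polar_def by (auto, metis IntI linear mem_Collect_eq)
  moreover have "y \<in> polar ?Z \<longleftrightarrow> y \<in> polar ?P \<or> y \<in> polar ?N"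
  proof
    assume Z: "y \<in> polar ?Z"
    show "y \<in> polar ?P \<or> y \<in> polar ?N"
    proof (rule ccontr)
      assume "\<not> ?thesis"
      then obtain p q where p: "p \<in> C" "a \<bullet> p \<ge> 0" "y \<bullet> p > 0" and q: "q \<in> C" "a \<bullet> q \<le> 0" "y \<bullet> q > 0"
        by (auto simp: polar_def not_le)
      then have "a \<bullet> p * (a \<bullet> q) \<le> 0" by (simp add: mult_nonneg_nonpos)
      then obtain u where u: "0 \<le> u" "u \<le> 1" "a \<bullet> ((1 - u) *\<^sub>R p + u *\<^sub>R q) = 0"
        by (rule segment_meets_hyperplane)
      let ?z = "(1 - u) *\<^sub>R p + u *\<^sub>R q"
      have "?z \<in> ?Z" using C p q u by (simp add: convex_alt)
      moreover have "y \<bullet> ?z > 0"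
      proof (cases "u = 0")
        case False
        then have "u * (y \<bullet> q) > 0" "(1 - u) * (y \<bullet> p) \<ge> 0" using u p q by simp_all
        then show ?thesis by (simp add: inner_add_right)
      qed (use p in simp)
      ultimately show False using Z by (force simp: polar_def)
    qed
  qed (auto simp: polar_def)
  ultimately show "indicator (polar ?P) y + indicator (polar ?N) y
      = (indicator (polar C) y + indicator (polar ?Z) y :: int)"
    by (auto simp: indicator_def)
qed

section \<open>Flats and the Moebius function\<close>

lemma sum_alternating_Pow:
  assumes "finite S" "S \<noteq> {}"
  shows "(\<Sum>B\<in>Pow S. (-1) ^ card B) = (0::int)"
proof -
  obtain a T where S: "S = insert a T" "a \<notin> T" using assms(2) by (metis Set.set_insert ex_in_conv)
  then have T: "finite T" using assms by simp
  have "card (insert a B) = card B + 1" if "B \<subseteq> T" for B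
    using that S T by (metis Suc_eq_plus1 card_insert_disjoint finite_subset subsetD)
  then show ?thesis unfolding S(1) sum_Pow_insert[OF T S(2)] by (intro sum.neutral) auto
qed

locale arrangement_normals =
  fixes U N :: "'a::euclidean_space set"
  assumes subspace_U: "subspace U" and finite_N: "finite N" and N_subset: "N \<subseteq> U" and zero_notin: "0 \<notin> N"
begin

definition normal_flats :: "'a set set" where
  "normal_flats = zero_locus U ` Pow N"

definition vanishing :: "'a set \<Rightarrow> 'a set" where
  "vanishing L = {a \<in> N. \<forall>x\<in>L. a \<bullet> x = 0}"

lemma finite_normal_flats: "finite normal_flats"
  by (simp add: normal_flats_def finite_N)

lemma flat_subset: "L \<in> normal_flats \<Longrightarrow> L \<subseteq> U"
  by (auto simp: normal_flats_def zero_locus_def)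

lemma flat_subspace: "L \<in> normal_flats \<Longrightarrow> subspace L"
  by (auto simp: normal_flats_def subspace_zero_locus subspace_U)

lemma U_flat: "U \<in> normal_flats"
  by (auto simp: normal_flats_def intro!: image_eqI[of _ _ "{}"])

lemma zero_locus_flat: "L \<in> normal_flats \<Longrightarrow> B \<subseteq> N \<Longrightarrow> zero_locus L B \<in> normal_flats"
  by (auto simp: normal_flats_def)

lemma zero_locus_vanishing: "L \<in> normal_flats \<Longrightarrow> zero_locus U (vanishing L) = L"
  by (auto simp: normal_flats_def vanishing_def zero_locus_def)

lemma vanishing_subset: "vanishing L \<subseteq> N"
  by (auto simp: vanishing_def)

lemma vanishing_U: "vanishing U = {}"
  using N_subset zero_notin by (auto simp: vanishing_def) (metis inner_eq_zero_iff subsetD)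

text \<open>
  The sums on the right satisfy the recursion that defines the Moebius function: summed over all
  flats between \<open>K\<close> and \<open>L\<close> they give the alternating sum over all subsets of those normals that
  vanish on \<open>K\<close> but not on \<open>L\<close>. That set of normals is nonempty for \<open>K \<subset> L\<close>, so the sum is \<open>0\<close>.
\<close>

lemma mobius_eq_sum:
  assumes L: "L \<in> normal_flats" and K: "K \<in> normal_flats" "K \<subseteq> L"
  shows "mobius normal_flats L K =
    (\<Sum>B\<in>{B \<in> Pow (N - vanishing L). zero_locus L B = K}. (-1) ^ card B)"
  using K
proof (induction "card {z \<in> normal_flats. K \<subset> z}" arbitrary: K rule: less_induct)
  case less
  let ?J = "N - vanishing L"
  define g where "g z = (\<Sum>B\<in>{B \<in> Pow ?J. zero_locus L B = z}. (-1) ^ card B :: int)" for z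
  show ?case
  proof (cases "K = L")
    case True
    have "B = {}" if "B \<subseteq> ?J" "zero_locus L B = L" for B
    proof (rule ccontr)
      assume "B \<noteq> {}"
      then obtain b where b: "b \<in> B" by auto
      have "\<forall>x\<in>zero_locus L B. b \<bullet> x = 0" using b by (simp add: zero_locus_def)
      with b that show False by (auto simp: vanishing_def)
    qed
    then have "{B \<in> Pow ?J. zero_locus L B = K} = {{}}" using True by auto
    then show ?thesis using True by (simp add: mobius.simps)
  next
    case False
    then have KL: "K \<subset> L" using less.prems by auto
    have IH: "mobius normal_flats L z = g z" if "z \<in> normal_flats" "z \<subseteq> L" "K \<subset> z" for z
      unfolding g_def
    proof (rule less.hyps[OF _ that(1,2)])
      have "{w \<in> normal_flats. z \<subset> w} \<subset> {w \<in> normal_flats. K \<subset> w}" using that by auto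
      then show "card {w \<in> normal_flats. z \<subset> w} < card {w \<in> normal_flats. K \<subset> w}"
        by (intro psubset_card_mono) (simp_all add: finite_normal_flats)
    qed
    let ?T = "{z \<in> normal_flats. z \<subseteq> L \<and> K \<subset> z}"
    define S where "S = Pow (?J \<inter> vanishing K)"
    have S: "S = {B \<in> Pow ?J. K \<subseteq> zero_locus L B}"
      using less.prems by (auto simp: S_def vanishing_def zero_locus_def)
    have "\<not> vanishing K \<subseteq> vanishing L"
    proof
      assume "vanishing K \<subseteq> vanishing L"
      then have "zero_locus U (vanishing L) \<subseteq> zero_locus U (vanishing K)"
        by (auto simp: zero_locus_def)
      then show False using KL by (simp add: zero_locus_vanishing L less.prems)
    qed
    then have "?J \<inter> vanishing K \<noteq> {}" using vanishing_subset by blast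
    then have "(\<Sum>B\<in>S. (-1) ^ card B) = (0::int)"
      unfolding S_def using finite_N by (intro sum_alternating_Pow) auto
    moreover have "(\<Sum>z\<in>insert K ?T. \<Sum>B\<in>{B \<in> S. zero_locus L B = z}. (-1) ^ card B)
        = (\<Sum>B\<in>S. (-1) ^ card B :: int)"
    proof (rule sum.group)
      show "zero_locus L ` S \<subseteq> insert K ?T"
        using zero_locus_flat[OF L] unfolding S by (auto simp: zero_locus_def)
    qed (auto simp: S_def finite_N finite_normal_flats)
    moreover have "{B \<in> S. zero_locus L B = z} = {B \<in> Pow ?J. zero_locus L B = z}"
      if "z \<in> insert K ?T" for z
      using that unfolding S by auto
    ultimately have "sum g (insert K ?T) = 0" by (simp add: g_def)
    moreover have "mobius normal_flats L K = - (\<Sum>z\<in>?T. mobius normal_flats L z)"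
      using KL by (subst mobius.simps) (auto simp: finite_normal_flats)
    moreover have "\<dots> = - sum g ?T" using IH by simp
    ultimately have "mobius normal_flats L K = g K" by (simp add: finite_normal_flats)
    then show ?thesis by (simp add: g_def)
  qed
qed

lemma abs_mobius:
  assumes L: "L \<in> normal_flats" and K: "K \<in> normal_flats" "K \<subseteq> L"
  shows "\<bar>mobius normal_flats L K\<bar> = whitney_sum L (N - vanishing L) (\<lambda>X. of_bool (X = K))"
proof -
  let ?w = "whitney_sum L (N - vanishing L) (\<lambda>X. of_bool (X = K))"
  have "?w = (\<Sum>B\<in>{B \<in> Pow (N - vanishing L). zero_locus L B = K}. (-1) ^ (card B + dim L + dim K))"
    unfolding whitney_sum_def using finite_N
    by (intro sum.mono_neutral_cong_right) auto
  also have "\<dots> = (-1) ^ (dim L + dim K) * mobius normal_flats L K"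
    unfolding mobius_eq_sum[OF assms] sum_distrib_left by (simp add: power_add mult_ac)
  finally have "?w = (-1) ^ (dim L + dim K) * mobius normal_flats L K" .
  moreover have "?w \<ge> 0"
    by (intro whitney_sum_nonneg flat_subspace L) (simp_all add: finite_N)
  ultimately show ?thesis by (cases "even (dim L + dim K)") simp_all
qed

lemma whitney_sum_eq_mobius_sum:
  assumes L: "L \<in> normal_flats"
  shows "whitney_sum L (N - vanishing L) v =
    (\<Sum>K\<in>{K \<in> normal_flats. K \<subseteq> L}. \<bar>mobius normal_flats L K\<bar> * v K)"
proof -
  let ?F = "{K \<in> normal_flats. K \<subseteq> L}"
  have "v (zero_locus L B) = (\<Sum>K\<in>?F. of_bool (zero_locus L B = K) * v K)" if "B \<in> Pow (N - vanishing L)" for B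
  proof -
    have "zero_locus L B \<in> ?F"
      using that zero_locus_flat[OF L] by (auto simp: zero_locus_def)
    then show ?thesis
      by (subst sum.remove[of _ "zero_locus L B"]) (auto simp: finite_normal_flats intro!: sum.neutral)
  qed
  then have "whitney_sum L (N - vanishing L) v = (\<Sum>B\<in>Pow (N - vanishing L).
      \<Sum>K\<in>?F. (-1) ^ (card B + dim L + dim (zero_locus L B)) * of_bool (zero_locus L B = K) * v K)"
    unfolding whitney_sum_def by (simp add: sum_distrib_left mult.assoc)
  also have "\<dots> = (\<Sum>K\<in>?F. whitney_sum L (N - vanishing L) (\<lambda>X. of_bool (X = K)) * v K)"
    unfolding whitney_sum_def by (subst sum.swap) (simp add: sum_distrib_right)
  finally show ?thesis using L by (simp add: abs_mobius)
qed

text \<open>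
  The intersections \<open>zero_locus U B\<close> that contain \<open>L\<close> are those with
  \<open>B \<subseteq> vanishing L\<close>. Hence the localized sum is the full sum over \<open>N\<close> of a function that is cut off to
  the flats above \<open>L\<close>, and the Moebius values are those of the whole lattice.
\<close>

lemma whitney_sum_localization:
  assumes L: "L \<in> normal_flats"
  shows "whitney_sum U (vanishing L) v =
    (\<Sum>M\<in>{M \<in> normal_flats. L \<subseteq> M}. \<bar>mobius normal_flats U M\<bar> * v M)"
proof -
  have "whitney_sum U (vanishing L) v = whitney_sum U N (\<lambda>X. if L \<subseteq> X then v X else 0)"
    unfolding whitney_sum_def
  proof (rule sum.mono_neutral_cong_left)
    show "\<forall>B\<in>Pow N - Pow (vanishing L).
        (-1) ^ (card B + dim U + dim (zero_locus U B)) *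
        (if L \<subseteq> zero_locus U B then v (zero_locus U B) else 0) = 0"
      by (auto simp: vanishing_def zero_locus_def)
    show "(-1) ^ (card B + dim U + dim (zero_locus U B)) * v (zero_locus U B) =
        (-1) ^ (card B + dim U + dim (zero_locus U B)) *
        (if L \<subseteq> zero_locus U B then v (zero_locus U B) else 0)" if "B \<in> Pow (vanishing L)" for B
      using that flat_subset[OF L] by (auto simp: vanishing_def zero_locus_def)
  qed (use vanishing_subset finite_N in auto)
  also have "\<dots> = (\<Sum>M\<in>{M \<in> normal_flats. M \<subseteq> U}. \<bar>mobius normal_flats U M\<bar> * (if L \<subseteq> M then v M else 0))"
    using whitney_sum_eq_mobius_sum[OF U_flat] by (simp add: vanishing_U)
  also have "\<dots> = (\<Sum>M\<in>{M \<in> normal_flats. L \<subseteq> M}. \<bar>mobius normal_flats U M\<bar> * v M)"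
    using flat_subset by (intro sum.mono_neutral_cong_right) (auto simp: finite_normal_flats)
  finally show ?thesis .
qed

end

section \<open>Chambers and their faces\<close>

text \<open>
  A connected set on which no form vanishes has constant signs, so an open cell cannot be enlarged.
\<close>

lemma components_complement:
  assumes V: "subspace V" and I: "finite I"
  shows "components {x \<in> V. \<forall>a\<in>I. a \<bullet> x \<noteq> 0} = open_cell V I ` topes V I"
proof -
  let ?S = "{x \<in> V. \<forall>a\<in>I. a \<bullet> x \<noteq> 0}"
  have cell: "open_cell V I P \<in> components ?S" if P: "P \<in> topes V I" for P
  proof -
    obtain p where p: "p \<in> open_cell V I P" using P by (auto simp: topes_def)
    have "d \<subseteq> open_cell V I P" if d: "open_cell V I P \<subseteq> d" "d \<subseteq> ?S" "connected d" for d
    proof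
      fix x assume x: "x \<in> d"
      have "if a \<in> P then a \<bullet> x > 0 else a \<bullet> x < 0" if a: "a \<in> I" for a
      proof (rule ccontr)
        assume neg: "\<not> ?thesis"
        have p': "if a \<in> P then a \<bullet> p > 0 else a \<bullet> p < 0" "p \<in> d"
          using p a d(1) by (auto simp: open_cell_def)
        have "\<exists>z\<in>d. a \<bullet> z = 0"
          using neg p' x connected_ivt_hyperplane[OF d(3) p'(2) x, of a 0]
            connected_ivt_hyperplane[OF d(3) x p'(2), of a 0]
          by (auto split: if_splits)
        then show False using d(2) a by auto
      qed
      then show "x \<in> open_cell V I P" using x d(2) by (auto simp: open_cell_def)
    qed
    moreover have "open_cell V I P \<subseteq> ?S" by (auto simp: open_cell_def split: if_splits)
    ultimately show ?thesis
      unfolding in_components_maximal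
      using p convex_connected[OF convex_open_cell[OF V], of I P] by (intro conjI allI impI) auto
  qed
  show ?thesis
  proof
    show "open_cell V I ` topes V I \<subseteq> components ?S" using cell by blast
    show "components ?S \<subseteq> open_cell V I ` topes V I"
    proof
      fix c assume c: "c \<in> components ?S"
      then obtain x where x: "x \<in> c" "x \<in> ?S"
        using in_components_nonempty in_components_subset by blast
      let ?P = "{a \<in> I. a \<bullet> x > 0}"
      have xP: "x \<in> open_cell V I ?P" using x(2) by (auto simp: open_cell_def not_less less_le)
      then have P: "?P \<in> topes V I" by (auto simp: topes_def)
      have "c = open_cell V I ?P"
        using components_nonoverlap[OF c cell[OF P]] x xP by auto
      then show "c \<in> open_cell V I ` topes V I" using P by blast
    qed
  qed
qed

lemma closures_of_chambers:
  assumes "subspace V" "finite I"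
  shows "closure ` components {x \<in> V. \<forall>a\<in>I. a \<bullet> x \<noteq> 0} = closed_cell V I ` topes V I"
proof -
  have "closure (open_cell V I P) = closed_cell V I P" if "P \<in> topes V I" for P
    using that closure_open_cell[OF assms(1)] by (auto simp: topes_def)
  then show ?thesis unfolding components_complement[OF assms] image_image by auto
qed

context arrangement_normals
begin

lemma closed_cell_Int_flat:
  assumes "L \<in> normal_flats"
  shows "closed_cell U N P \<inter> L = closed_cell L (N - vanishing L) (P - vanishing L)"
  using flat_subset[OF assms] by (auto simp: closed_cell_def vanishing_def)

text \<open>
  Each form that vanishes on \<open>L\<close> has constant sign on the cell. If it is zero inside a segment of the
  cell, it is therefore zero at both endpoints.
\<close>

lemma flat_face:
  assumes L: "L \<in> normal_flats"
  shows "closed_cell U N P \<inter> L face_of closed_cell U N P"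
  unfolding face_of_def
proof (intro conjI ballI impI)
  show "convex (closed_cell U N P \<inter> L)"
    by (intro convex_Int convex_closed_cell subspace_imp_convex subspace_U flat_subspace L)
next
  fix a b x
  assume ab: "a \<in> closed_cell U N P" "b \<in> closed_cell U N P"
    and x: "x \<in> closed_cell U N P \<inter> L" "x \<in> open_segment a b"
  obtain u where u: "0 < u" "u < 1" "x = (1 - u) *\<^sub>R a + u *\<^sub>R b"
    using x(2) by (auto simp: in_segment)
  have "n \<bullet> a = 0 \<and> n \<bullet> b = 0" if n: "n \<in> vanishing L" for n
  proof -
    have N: "n \<in> N" "n \<bullet> x = 0" using n x by (auto simp: vanishing_def)
    then have sum0: "(1 - u) * (n \<bullet> a) + u * (n \<bullet> b) = 0" using u by (simp add: inner_add_right)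
    show ?thesis
    proof (cases "n \<in> P")
      case True
      then have "n \<bullet> a \<ge> 0" "n \<bullet> b \<ge> 0" using ab N by (auto simp: closed_cell_def)
      then have "(1 - u) * (n \<bullet> a) = 0" "u * (n \<bullet> b) = 0"
        using sum0 u by (simp_all add: add_nonneg_eq_0_iff)
      then show ?thesis using u by simp
    next
      case False
      then have "n \<bullet> a \<le> 0" "n \<bullet> b \<le> 0" using ab N by (auto simp: closed_cell_def)
      then have "(1 - u) * (n \<bullet> a) = 0" "u * (n \<bullet> b) = 0"
        using sum0 u by (simp_all add: add_nonpos_eq_0_iff mult_nonneg_nonpos)
      then show ?thesis using u by simp
    qed
  qed
  then have "a \<in> zero_locus U (vanishing L)" "b \<in> zero_locus U (vanishing L)"
    using ab by (auto simp: zero_locus_def closed_cell_def)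
  then show "a \<in> closed_cell U N P \<inter> L" "b \<in> closed_cell U N P \<inter> L"
    using ab by (simp_all add: zero_locus_vanishing L)
qed auto

lemma aff_dim_cell:
  assumes V: "subspace V" "finite I" and P: "P \<in> topes V I"
  shows "aff_dim (closed_cell V I P) = int (dim V)"
proof -
  obtain p where p: "p \<in> open_cell V I P" using P by (auto simp: topes_def)
  have "dim (closed_cell V I P) = dim V"
    using span_closed_cell[OF V p] by (metis dim_span)
  moreover have "0 \<in> affine hull (closed_cell V I P)"
    using zero_in_closed_cell[OF V(1)] by (simp add: hull_inc)
  ultimately show ?thesis by (simp add: aff_dim_zero)
qed

text \<open>
  Take \<open>p\<close> in the relative interior of \<open>F\<close> and let \<open>L\<close> be the common zero set of the normals that vanish
  at \<open>p\<close>. These normals have constant sign on the cell and vanish at a relatively interior point of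
  \<open>F\<close>, so they vanish on \<open>F\<close>. Conversely, all other normals are strict at \<open>p\<close>, so a segment from
  any point of the cell in \<open>L\<close> to \<open>p\<close> can be prolonged beyond \<open>p\<close> within the cell, and the face
  property puts its endpoints into \<open>F\<close>.
\<close>

lemma face_is_flat_face:
  assumes F: "F face_of closed_cell U N P" "F \<noteq> {}" and P: "P \<subseteq> N"
  obtains L where "L \<in> normal_flats" "P - vanishing L \<in> topes L (N - vanishing L)"
    "F = closed_cell U N P \<inter> L"
proof -
  let ?C = "closed_cell U N P"
  have cF: "convex F" using F face_of_imp_convex by blast
  then obtain p where p: "p \<in> rel_interior F" using F(2) rel_interior_eq_empty by blast
  then have pF: "p \<in> F" using rel_interior_subset by auto
  have FC: "F \<subseteq> ?C" using F face_of_imp_subset by blast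
  define B where "B = {a \<in> N. a \<bullet> p = 0}"
  define L where "L = zero_locus U B"
  have L: "L \<in> normal_flats" by (auto simp: normal_flats_def L_def B_def)
  have pL: "p \<in> L" using pF FC by (auto simp: L_def B_def zero_locus_def closed_cell_def)
  then have B: "vanishing L = B" by (auto simp: vanishing_def L_def B_def zero_locus_def)
  let ?J = "N - vanishing L" and ?Q = "P - vanishing L"
  have p_open: "p \<in> open_cell L ?J ?Q"
    using pL pF FC by (fastforce simp: B B_def open_cell_def closed_cell_def less_le)
  have "F \<subseteq> L"
  proof
    fix y assume y: "y \<in> F"
    obtain e where e: "e > 1" "(1 - e) *\<^sub>R y + e *\<^sub>R p \<in> F"
      using p y convex_rel_interior_iff[OF cF F(2)] by blast
    have "a \<bullet> y = 0" if a: "a \<in> B" for a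
    proof -
      have aN: "a \<in> N" "a \<bullet> p = 0" using a by (auto simp: B_def)
      have "if a \<in> P then a \<bullet> y \<ge> 0 \<and> (1 - e) * (a \<bullet> y) \<ge> 0 else a \<bullet> y \<le> 0 \<and> (1 - e) * (a \<bullet> y) \<le> 0"
        using y e(2) FC aN by (fastforce simp: closed_cell_def inner_add_right)
      then show ?thesis using e(1) by (auto simp: zero_le_mult_iff mult_le_0_iff split: if_splits)
    qed
    then show "y \<in> L" using y FC by (auto simp: L_def zero_locus_def closed_cell_def)
  qed
  moreover have "?C \<inter> L \<subseteq> F"
  proof
    fix x assume x: "x \<in> ?C \<inter> L"
    show "x \<in> F"
    proof (cases "x = p")
      case False
      have "p - x \<in> L" using pL x flat_subspace[OF L] by (simp add: subspace_diff)
      then obtain e where e: "e > 0" "p + e *\<^sub>R (p - x) \<in> open_cell L ?J ?Q"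
        using open_cell_perturb[OF flat_subspace[OF L] _ p_open] finite_N by blast
      let ?q = "p + e *\<^sub>R (p - x)"
      have "?q \<in> ?C"
        using e(2) open_cell_subset_closed_cell closed_cell_Int_flat[OF L, of P] by blast
      \<comment> \<open>solving \<open>p = (1 - u) *\<^sub>R x + u *\<^sub>R ?q\<close> gives \<open>u = 1 / (1 + e)\<close>\<close>
      moreover have "p \<in> open_segment x ?q"
      proof -
        have "(1 - 1 / (1 + e)) *\<^sub>R x + (1 / (1 + e)) *\<^sub>R ?q
            = (1 / (1 + e)) *\<^sub>R (((1 + e) * (1 - 1 / (1 + e))) *\<^sub>R x + ?q)"
          using e(1) by (simp add: scaleR_add_right)
        also have "(1 + e) * (1 - 1 / (1 + e)) = e" using e(1) by (simp add: field_simps)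
        also have "e *\<^sub>R x + ?q = (1 + e) *\<^sub>R p" by (simp add: algebra_simps)
        finally have "p = (1 - 1 / (1 + e)) *\<^sub>R x + (1 / (1 + e)) *\<^sub>R ?q" using e(1) by simp
        moreover have "0 < 1 / (1 + e)" "1 / (1 + e) < 1" using e(1) by simp_all
        moreover have "x \<noteq> ?q"
        proof
          assume "x = ?q"
          then have "(1 + e) *\<^sub>R (p - x) = 0" by (simp add: algebra_simps)
          then show False using e(1) False by simp
        qed
        ultimately show ?thesis unfolding in_segment by blast
      qed
      ultimately show ?thesis using face_ofD[OF F(1)] x pF by blast
    qed (use pF in simp)
  qed
  ultimately have "F = ?C \<inter> L" using FC by blast
  moreover have "?Q \<in> topes L ?J" using p_open P by (auto simp: topes_def)
  ultimately show ?thesis using L that by blast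
qed

text \<open>
  These index the \<open>k\<close>-dimensional faces of the chamber closure of \<open>P\<close>. The condition on the sign pattern says
  that the face \<open>closed_cell U N P \<inter> L\<close> has a relatively open part in \<open>L\<close> and therefore spans \<open>L\<close>, so
  that distinct flats give distinct faces.
\<close>

definition chamber_flats :: "nat \<Rightarrow> 'a set \<Rightarrow> 'a set set" where
  "chamber_flats k P =
     {L \<in> normal_flats. dim L = k \<and> P - vanishing L \<in> topes L (N - vanishing L)}"

lemma faces_dim_closed_cell:
  assumes P: "P \<subseteq> N"
  shows "bij_betw (\<lambda>L. closed_cell U N P \<inter> L) (chamber_flats k P) (faces_dim k (closed_cell U N P))"
  unfolding bij_betw_def
proof
  let ?C = "closed_cell U N P"
  have aff: "aff_dim (?C \<inter> L) = int (dim L) \<and> span (?C \<inter> L) = L"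
    if "L \<in> normal_flats" "P - vanishing L \<in> topes L (N - vanishing L)" for L
    using that aff_dim_cell[of L] span_closed_cell[of L] flat_subspace finite_N
    by (fastforce simp: closed_cell_Int_flat topes_def)
  show "inj_on (\<lambda>L. ?C \<inter> L) (chamber_flats k P)"
    by (rule inj_onI) (metis (mono_tags, lifting) aff chamber_flats_def mem_Collect_eq)
  show "(\<lambda>L. ?C \<inter> L) ` chamber_flats k P = faces_dim k ?C"
  proof
    have "0 \<in> ?C \<inter> L" if "L \<in> normal_flats" for L
      using that by (simp add: zero_in_closed_cell subspace_U subspace_0 flat_subspace)
    then show "(\<lambda>L. ?C \<inter> L) ` chamber_flats k P \<subseteq> faces_dim k ?C"
      using aff flat_face unfolding chamber_flats_def faces_dim_def by fastforce
    show "faces_dim k ?C \<subseteq> (\<lambda>L. ?C \<inter> L) ` chamber_flats k P"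
    proof
      fix F assume F: "F \<in> faces_dim k ?C"
      then obtain L where L: "L \<in> normal_flats" "P - vanishing L \<in> topes L (N - vanishing L)" "F = ?C \<inter> L"
        using face_is_flat_face[OF _ _ P, of F] by (auto simp: faces_dim_def)
      then have "L \<in> chamber_flats k P" using F aff[OF L(1,2)] by (simp add: faces_dim_def chamber_flats_def)
      then show "F \<in> (\<lambda>L. ?C \<inter> L) ` chamber_flats k P" using L by blast
    qed
  qed
qed

text \<open>
  A vector of the normal cone vanishes on the face, which is closed under scaling. Near a point \<open>q\<close> in
  the relative interior of the face only the normals in \<open>vanishing L\<close> are active, so for \<open>x\<close> in the
  localized cell the point \<open>q + e *\<^sub>R x\<close> lies in the chamber closure for small \<open>e > 0\<close>, and the
  bound on \<open>q + e *\<^sub>R x\<close> becomes the bound on \<open>x\<close>.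
\<close>

lemma normal_cone_flat_face:
  assumes L: "L \<in> normal_flats" and P: "P - vanishing L \<in> topes L (N - vanishing L)"
  shows "normal_cone (closed_cell U N P \<inter> L) (closed_cell U N P)
    = polar (closed_cell U (vanishing L) (P \<inter> vanishing L))"
proof
  let ?C = "closed_cell U N P" and ?Z = "vanishing L"
  let ?D = "closed_cell U ?Z (P \<inter> ?Z)"
  obtain q where q: "q \<in> open_cell L (N - ?Z) (P - ?Z)" using P by (auto simp: topes_def)
  then have qF: "q \<in> ?C \<inter> L"
    using open_cell_subset_closed_cell closed_cell_Int_flat[OF L, of P] by blast
  show "normal_cone (?C \<inter> L) ?C \<subseteq> polar ?D"
  proof
    fix c assume "c \<in> normal_cone (?C \<inter> L) ?C"
    then have c: "c \<bullet> x \<le> c \<bullet> y" if "x \<in> ?C" "y \<in> ?C \<inter> L" for x y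
      using that by (auto simp: normal_cone_def)
    \<comment> \<open>the maximum of \<open>c\<close> over the cell is attained at \<open>q\<close>; compare with \<open>2 *\<^sub>R q\<close> and \<open>0\<close>\<close>
    have cq: "c \<bullet> q = 0"
    proof -
      have "2 *\<^sub>R q \<in> ?C" "0 \<in> ?C"
        using closed_cell_scale[OF subspace_U, of q N P 2] qF
        by (simp_all add: zero_in_closed_cell subspace_U)
      with c[OF _ qF] have "c \<bullet> (2 *\<^sub>R q) \<le> c \<bullet> q" "c \<bullet> 0 \<le> c \<bullet> q" by blast+
      then show ?thesis by simp
    qed
    show "c \<in> polar ?D"
      unfolding polar_def
    proof (intro CollectI ballI)
      fix x assume x: "x \<in> ?D"
      obtain e where e: "e > 0" "\<forall>a\<in>N - ?Z. sgn (a \<bullet> (q + e *\<^sub>R x)) = sgn (a \<bullet> q)"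
        using small_perturbation[OF finite_Diff[OF finite_N] open_cell_nonzero[OF q], where r = x] .
      have "q + e *\<^sub>R x \<in> ?C"
        unfolding closed_cell_def
      proof (intro CollectI conjI ballI)
        show "q + e *\<^sub>R x \<in> U"
          using qF x by (auto simp: closed_cell_def subspace_U subspace_add subspace_scale)
        fix a assume a: "a \<in> N"
        show "if a \<in> P then a \<bullet> (q + e *\<^sub>R x) \<ge> 0 else a \<bullet> (q + e *\<^sub>R x) \<le> 0"
        proof (cases "a \<in> ?Z")
          case True
          then have "a \<bullet> q = 0" using qF by (auto simp: vanishing_def)
          then show ?thesis
            using True x e(1) by (auto simp: closed_cell_def inner_add_right mult_nonneg_nonpos)
        next
          case False
          then have "if a \<in> P then a \<bullet> q > 0 else a \<bullet> q < 0"
            using q a by (auto simp: open_cell_def)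
          moreover have "sgn (a \<bullet> (q + e *\<^sub>R x)) = sgn (a \<bullet> q)" using e(2) a False by simp
          ultimately show ?thesis by (auto simp: sgn_1_pos sgn_1_neg split: if_splits)
        qed
      qed
      then have "c \<bullet> (q + e *\<^sub>R x) \<le> c \<bullet> q" using c qF by blast
      then show "c \<bullet> x \<le> 0" using cq e(1) by (simp add: inner_add_right mult_le_0_iff)
    qed
  qed
  show "polar ?D \<subseteq> normal_cone (?C \<inter> L) ?C"
  proof
    fix c assume "c \<in> polar ?D"
    then have c: "c \<bullet> x \<le> 0" if "x \<in> ?D" for x using that by (auto simp: polar_def)
    have "c \<bullet> y \<ge> 0" if y: "y \<in> ?C \<inter> L" for y
    proof -
      have "- y \<in> ?D"
        using y flat_subset[OF L] by (auto simp: closed_cell_def vanishing_def subspace_U subspace_neg)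
      from c[OF this] show ?thesis by simp
    qed
    moreover have "?C \<subseteq> ?D" using vanishing_subset by (auto simp: closed_cell_def)
    ultimately show "c \<in> normal_cone (?C \<inter> L) ?C"
      using c unfolding normal_cone_def by (blast intro: order_trans)
  qed
qed

lemma flat_subset_localized_cell:
  "L \<in> normal_flats \<Longrightarrow> L \<subseteq> closed_cell U (vanishing L) P"
  using flat_subset by (auto simp: closed_cell_def vanishing_def)

text \<open>
  A pair of sign patterns, realized by \<open>q \<in> L\<close> and by \<open>r \<in> U\<close>, is jointly realized by
  \<open>q + e *\<^sub>R r\<close> for small \<open>e > 0\<close>: normals vanishing on \<open>L\<close> see only \<open>r\<close>, and for all others
  \<open>q\<close> dominates.
\<close>

lemma topes_decompose:
  assumes L: "L \<in> normal_flats"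
  shows "bij_betw (\<lambda>P. (P - vanishing L, P \<inter> vanishing L))
    {P \<in> topes U N. P - vanishing L \<in> topes L (N - vanishing L)}
    (topes L (N - vanishing L) \<times> topes U (vanishing L))"
proof (rule bij_betw_byWitness[where f' = "\<lambda>(Q, R). Q \<union> R"])
  let ?Z = "vanishing L"
  let ?T = "{P \<in> topes U N. P - ?Z \<in> topes L (N - ?Z)}"
  show "(\<lambda>P. (P - ?Z, P \<inter> ?Z)) ` ?T \<subseteq> topes L (N - ?Z) \<times> topes U ?Z"
    using vanishing_subset by (fastforce simp: topes_def open_cell_def)
  show "(\<lambda>(Q, R). Q \<union> R) ` (topes L (N - ?Z) \<times> topes U ?Z) \<subseteq> ?T"
  proof clarify
    fix Q R assume Q: "Q \<in> topes L (N - ?Z)" and R: "R \<in> topes U ?Z"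
    then obtain q r where q: "q \<in> open_cell L (N - ?Z) Q" and r: "r \<in> open_cell U ?Z R"
      by (auto simp: topes_def)
    have sub: "Q \<subseteq> N - ?Z" "R \<subseteq> ?Z" using Q R by (auto simp: topes_def)
    obtain e where e: "e > 0" "\<forall>a\<in>N - ?Z. sgn (a \<bullet> (q + e *\<^sub>R r)) = sgn (a \<bullet> q)"
      using small_perturbation[OF finite_Diff[OF finite_N] open_cell_nonzero[OF q], where r = r] .
    have "q + e *\<^sub>R r \<in> open_cell U N (Q \<union> R)"
      unfolding open_cell_def
    proof (intro CollectI conjI ballI)
      show "q + e *\<^sub>R r \<in> U"
        using q r flat_subset[OF L] by (auto simp: open_cell_def subspace_U intro!: subspace_add subspace_scale)
      fix a assume a: "a \<in> N"
      show "if a \<in> Q \<union> R then a \<bullet> (q + e *\<^sub>R r) > 0 else a \<bullet> (q + e *\<^sub>R r) < 0"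
      proof (cases "a \<in> ?Z")
        case True
        then have "a \<bullet> q = 0" using q by (auto simp: vanishing_def open_cell_def)
        moreover have "a \<notin> Q" using True sub by auto
        ultimately show ?thesis
          using True r e(1) by (auto simp: open_cell_def inner_add_right mult_pos_neg)
      next
        case False
        then have "if a \<in> Q then a \<bullet> q > 0 else a \<bullet> q < 0" using q a by (auto simp: open_cell_def)
        moreover have "sgn (a \<bullet> (q + e *\<^sub>R r)) = sgn (a \<bullet> q)" using e(2) a False by simp
        moreover have "a \<notin> R" using False sub by auto
        ultimately show ?thesis by (auto simp: sgn_1_pos sgn_1_neg split: if_splits)
      qed
    qed
    then have "Q \<union> R \<in> topes U N" using sub vanishing_subset by (auto simp: topes_def)
    moreover have "Q \<union> R - ?Z = Q" using sub by auto
    ultimately show "Q \<union> R \<in> topes U N \<and> Q \<union> R - ?Z \<in> topes L (N - ?Z)" using Q by simp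
  qed
  show "\<forall>P\<in>?T. (case (P - ?Z, P \<inter> ?Z) of (Q, R) \<Rightarrow> Q \<union> R) = P" by auto
  show "\<forall>p\<in>topes L (N - ?Z) \<times> topes U ?Z. ((case p of (Q, R) \<Rightarrow> Q \<union> R) - ?Z, (case p of (Q, R) \<Rightarrow> Q \<union> R) \<inter> ?Z) = p"
    by (auto simp: topes_def)
qed

end

section \<open>Splitting along a flat and its orthogonal complement\<close>

lemma indicator_plus_orthogonal:
  fixes L :: "'a::euclidean_space set"
  assumes L: "subspace L" and A: "A \<subseteq> L" and B: "B \<subseteq> L\<^sup>\<bottom>" and y: "y \<in> L" and z: "z \<in> L\<^sup>\<bottom>"
  shows "indicator (A + B) (y + z) = (indicator A y * indicator B z :: int)"
proof -
  have "y \<in> A \<and> z \<in> B" if "y + z \<in> A + B"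
  proof -
    obtain a b where ab: "a \<in> A" "b \<in> B" "y + z = a + b" using \<open>y + z \<in> A + B\<close> by (auto simp: set_plus_def)
    have "y - a \<in> L" using ab A y L by (auto simp: subspace_diff)
    moreover have "b - z \<in> L\<^sup>\<bottom>" using ab B z by (auto simp: subspace_orthogonal_comp subspace_diff)
    moreover have eq: "y - a = b - z" using ab(3) by (simp add: algebra_simps)
    ultimately have "(y - a) \<bullet> (y - a) = 0" by (simp add: orthogonal_comp_def orthogonal_def)
    then show ?thesis using ab eq by simp
  qed
  then show ?thesis by (auto simp: indicator_def set_plus_intro)
qed

lemma polar_subspace: "subspace L \<Longrightarrow> polar L = L\<^sup>\<bottom>"
proof (intro equalityI subsetI)
  fix c assume L: "subspace L" and c: "c \<in> polar L"
  have "c \<bullet> x = 0" if "x \<in> L" for x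
  proof -
    have "c \<bullet> x \<le> 0" "c \<bullet> (- x) \<le> 0"
      using c that subspace_neg[OF L that] unfolding polar_def by blast+
    then show ?thesis by simp
  qed
  then show "c \<in> L\<^sup>\<bottom>" by (simp add: orthogonal_comp_def orthogonal_def inner_commute)
qed (auto simp: polar_def orthogonal_comp_def orthogonal_def inner_commute)

lemma polar_mono: "A \<subseteq> B \<Longrightarrow> polar B \<subseteq> polar A"
  by (auto simp: polar_def)

context arrangement_normals
begin

lemma V_cone_closed_cell:
  assumes P: "P \<subseteq> N"
  shows "V_cone k (closed_cell U N P) x = (\<Sum>L\<in>chamber_flats k P.
    indicator (closed_cell L (N - vanishing L) (P - vanishing L)
      + polar (closed_cell U (vanishing L) (P \<inter> vanishing L))) x)"
  unfolding V_cone_def sum.reindex_bij_betw[OF faces_dim_closed_cell[OF P], symmetric]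
  by (intro sum.cong refl)
    (simp add: Pi_face_def chamber_flats_def normal_cone_flat_face flip: closed_cell_Int_flat)

text \<open>
  The contribution of one flat \<open>L\<close> to the left-hand side of the identity, evaluated at \<open>y + z\<close>. The
  pairs of chambers decouple because the face lies in \<open>L\<close> and the normal cone in its orthogonal
  complement.
\<close>

lemma sum_local_cells:
  assumes L: "L \<in> normal_flats" and y: "y \<in> L" and z: "z \<in> L\<^sup>\<bottom>"
  shows "(\<Sum>P\<in>{P \<in> topes U N. P - vanishing L \<in> topes L (N - vanishing L)}.
      indicator (closed_cell L (N - vanishing L) (P - vanishing L)
        + polar (closed_cell U (vanishing L) (P \<inter> vanishing L))) (y + z))
    = (\<Sum>K\<in>{K \<in> normal_flats. K \<subseteq> L}. \<bar>mobius normal_flats L K\<bar> * indicator K y)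
      * (\<Sum>M\<in>{M \<in> normal_flats. L \<subseteq> M}. \<bar>mobius normal_flats U M\<bar> * indicator (M\<^sup>\<bottom>) z)"
    (is "?lhs = ?K * ?M")
proof -
  let ?Z = "vanishing L"
  let ?h = "\<lambda>(Q, R). indicator (closed_cell L (N - ?Z) Q + polar (closed_cell U ?Z R)) (y + z) :: int"
  have sL: "subspace L" by (rule flat_subspace[OF L])
  have fin: "finite (N - ?Z)" "finite ?Z"
    using finite_N vanishing_subset by (auto intro: finite_subset)
  have "?lhs = (\<Sum>p\<in>topes L (N - ?Z) \<times> topes U ?Z. ?h p)"
    by (subst sum.reindex_bij_betw[OF topes_decompose[OF L], symmetric]) simp
  also have "\<dots> = (\<Sum>Q\<in>topes L (N - ?Z). \<Sum>R\<in>topes U ?Z.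
      indicator (closed_cell L (N - ?Z) Q) y * indicator (polar (closed_cell U ?Z R)) z)"
    unfolding sum.cartesian_product
  proof (rule sum.cong[OF refl], clarify)
    fix Q R
    have "polar (closed_cell U ?Z R) \<subseteq> L\<^sup>\<bottom>"
      using polar_mono[OF flat_subset_localized_cell[OF L]] polar_subspace[OF sL] by simp
    moreover have "closed_cell L (N - ?Z) Q \<subseteq> L" by (auto simp: closed_cell_def)
    ultimately show "indicator (closed_cell L (N - ?Z) Q + polar (closed_cell U ?Z R)) (y + z) =
        (indicator (closed_cell L (N - ?Z) Q) y * indicator (polar (closed_cell U ?Z R)) z :: int)"
      using indicator_plus_orthogonal[OF sL] y z by blast
  qed
  also have "\<dots> = (\<Sum>Q\<in>topes L (N - ?Z). indicator (closed_cell L (N - ?Z) Q) y)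
      * (\<Sum>R\<in>topes U ?Z. indicator (polar (closed_cell U ?Z R)) z)"
    by (simp only: sum_product)
  also have "(\<Sum>Q\<in>topes L (N - ?Z). indicator (closed_cell L (N - ?Z) Q) y) = ?K"
    unfolding sum_topes_eq_whitney_sum[OF splits_membership fin(1) sL]
    by (rule whitney_sum_eq_mobius_sum[OF L])
  also have "(\<Sum>R\<in>topes U ?Z. indicator (polar (closed_cell U ?Z R)) z)
      = (\<Sum>M\<in>{M \<in> normal_flats. L \<subseteq> M}. \<bar>mobius normal_flats U M\<bar> * indicator (polar M) z)"
    unfolding sum_topes_eq_whitney_sum[OF splits_polar fin(2) subspace_U]
    by (rule whitney_sum_localization[OF L])
  also have "\<dots> = ?M"
    by (intro sum.cong) (simp_all add: polar_subspace flat_subspace)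
  finally show ?thesis .
qed

end

section \<open>The cone product of integer combinations\<close>

\<comment> \<open>these rules would turn sums of multiples of indicators into sums over filtered index sets\<close>
declare sum_mult_indicator [simp del] sum_indicator_mult [simp del]

lemma subspace_in_Cones: "subspace V \<Longrightarrow> V \<in> Cones"
  by (auto simp: Cones_def affine_imp_polyhedron subspace_imp_affine cone_def subspace_scale dest: subspace_0)

lemma sum_in_cone_group:
  assumes "finite S" "\<And>s. s \<in> S \<Longrightarrow> A s \<in> Cones"
  shows "(\<lambda>x. \<Sum>s\<in>S. c s * indicator (A s) x) \<in> cone_group"
  using assms
proof (induction S)
  case (insert s S)
  then have "(\<lambda>x. c s * indicator (A s) x + (\<Sum>s\<in>S. c s * indicator (A s) x)) \<in> cone_group"
    by (intro add_mem_cone_group scale_mem_cone_group indicator_mem_cone_group) auto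
  then show ?case using insert.hyps by simp
qed (simp add: zero_mem_cone_group)

text \<open>
  Additivity is assumed only on the cone group, so every partial sum has to be shown to lie in it.
\<close>

lemma additive_sum:
  fixes T :: "('a::euclidean_space \<Rightarrow> int) \<Rightarrow> 'a \<Rightarrow> int"
  assumes add: "\<And>f g. f \<in> cone_group \<Longrightarrow> g \<in> cone_group \<Longrightarrow> T (\<lambda>x. f x + g x) = (\<lambda>x. T f x + T g x)"
    and "finite S" "\<And>s. s \<in> S \<Longrightarrow> A s \<in> Cones"
  shows "T (\<lambda>x. \<Sum>s\<in>S. c s * indicator (A s) x) = (\<lambda>x. \<Sum>s\<in>S. c s * T (indicator (A s)) x)"
  using assms(2,3)
proof (induction S)
  case empty
  show ?case using add[OF zero_mem_cone_group zero_mem_cone_group] by (simp add: fun_eq_iff)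
next
  case (insert s S)
  then have s: "indicator (A s) \<in> cone_group" by (simp add: indicator_mem_cone_group)
  have sum: "(\<lambda>x. \<Sum>s\<in>S. c s * indicator (A s) x) \<in> cone_group"
    using insert by (intro sum_in_cone_group) auto
  have "T (\<lambda>x. c s * indicator (A s) x) = (\<lambda>x. c s * T (indicator (A s)) x)"
    by (rule additive_scale[OF _ s]) (rule add)
  then show ?case
    using insert add[OF scale_mem_cone_group[OF s] sum] by simp
qed

lemma cone_product_sum:
  assumes S: "finite S" "\<And>s. s \<in> S \<Longrightarrow> A s \<in> Cones" and T: "finite T" "\<And>t. t \<in> T \<Longrightarrow> D t \<in> Cones"
  shows "((\<lambda>y. \<Sum>s\<in>S. f s * indicator (A s) y) \<star> (\<lambda>y. \<Sum>t\<in>T. g t * indicator (D t) y)) x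
    = (\<Sum>s\<in>S. f s * (\<Sum>t\<in>T. g t * indicator (A s + D t) x))"
proof -
  note prod = is_cone_productD[OF is_cone_product_cone_product]
  let ?G = "\<lambda>y. \<Sum>t\<in>T. g t * indicator (D t) y"
  have G: "?G \<in> cone_group" by (rule sum_in_cone_group[OF T])
  have "((\<lambda>y. \<Sum>s\<in>S. f s * indicator (A s) y) \<star> ?G) = (\<lambda>x. \<Sum>s\<in>S. f s * (indicator (A s) \<star> ?G) x)"
    by (rule additive_sum[where T = "\<lambda>f. f \<star> ?G", OF _ S]) (rule prod(1)[OF _ _ G])
  moreover have "indicator (A s) \<star> ?G = (\<lambda>x. \<Sum>t\<in>T. g t * indicator (A s + D t) x)" if s: "s \<in> S" for s
  proof -
    have A: "indicator (A s) \<in> cone_group" using S(2)[OF s] by (rule indicator_mem_cone_group)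
    have "indicator (A s) \<star> ?G = (\<lambda>x. \<Sum>t\<in>T. g t * (indicator (A s) \<star> indicator (D t)) x)"
      by (rule additive_sum[OF _ T]) (rule prod(2)[OF _ _ A])
    then show ?thesis using prod(3)[OF S(2)[OF s] T(2)] by simp
  qed
  ultimately show ?thesis by simp
qed

section \<open>The identity\<close>

context arrangement_normals
begin

lemma cone_product_flats:
  assumes L: "L \<in> normal_flats" and y: "y \<in> L" and z: "z \<in> L\<^sup>\<bottom>"
  shows "((\<lambda>y. \<Sum>K\<in>{K \<in> normal_flats. K \<subseteq> L}. f K * indicator K y)
      \<star> (\<lambda>y. \<Sum>M\<in>{M \<in> normal_flats. L \<subseteq> M}. g M * indicator (M\<^sup>\<bottom>) y)) (y + z)
    = (\<Sum>K\<in>{K \<in> normal_flats. K \<subseteq> L}. f K * indicator K y)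
      * (\<Sum>M\<in>{M \<in> normal_flats. L \<subseteq> M}. g M * indicator (M\<^sup>\<bottom>) z)"
proof -
  have "indicator (K + M\<^sup>\<bottom>) (y + z) = (indicator K y * indicator (M\<^sup>\<bottom>) z :: int)"
    if "K \<subseteq> L" "L \<subseteq> M" for K M
  proof (rule indicator_plus_orthogonal[OF flat_subspace[OF L] that(1) _ y z])
    show "M\<^sup>\<bottom> \<subseteq> L\<^sup>\<bottom>" using that(2) by (auto simp: orthogonal_comp_def)
  qed
  then show ?thesis
    unfolding sum_product
    by (subst cone_product_sum)
      (simp_all add: finite_normal_flats subspace_in_Cones flat_subspace subspace_orthogonal_comp
        sum_distrib_left mult_ac)
qed

lemma sum_V_cone:
  "(\<Sum>P\<in>topes U N. V_cone k (closed_cell U N P) x) = (\<Sum>L\<in>{L \<in> normal_flats. dim L = k}.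
      ((\<lambda>y. \<Sum>K\<in>{K \<in> normal_flats. K \<subseteq> L}. \<bar>mobius normal_flats L K\<bar> * indicator K y)
       \<star> (\<lambda>y. \<Sum>M\<in>{M \<in> normal_flats. L \<subseteq> M}. \<bar>mobius normal_flats U M\<bar> * indicator (M\<^sup>\<bottom>) y)) x)"
proof -
  let ?F = "{L \<in> normal_flats. dim L = k}"
  define h where "h P L = (indicator (closed_cell L (N - vanishing L) (P - vanishing L)
      + polar (closed_cell U (vanishing L) (P \<inter> vanishing L))) x :: int)" for P L
  let ?c = "\<lambda>P L. P - vanishing L \<in> topes L (N - vanishing L)"
  have "(\<Sum>P\<in>topes U N. V_cone k (closed_cell U N P) x) = (\<Sum>P\<in>topes U N. \<Sum>L\<in>{L \<in> ?F. ?c P L}. h P L)"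
    by (intro sum.cong refl) (simp add: topes_def V_cone_closed_cell chamber_flats_def h_def conj_assoc)
  also have "\<dots> = (\<Sum>L\<in>?F. \<Sum>P\<in>{P \<in> topes U N. ?c P L}. h P L)"
    by (rule sum.swap_restrict) (simp_all add: finite_topes finite_N finite_normal_flats)
  also have "\<dots> = (\<Sum>L\<in>?F.
      ((\<lambda>y. \<Sum>K\<in>{K \<in> normal_flats. K \<subseteq> L}. \<bar>mobius normal_flats L K\<bar> * indicator K y)
       \<star> (\<lambda>y. \<Sum>M\<in>{M \<in> normal_flats. L \<subseteq> M}. \<bar>mobius normal_flats U M\<bar> * indicator (M\<^sup>\<bottom>) y)) x)"
  proof (rule sum.cong[OF refl])
    fix L assume "L \<in> ?F"
    then have L: "L \<in> normal_flats" by simp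
    obtain y z where "y \<in> span L" "\<And>w. w \<in> span L \<Longrightarrow> orthogonal z w" and x: "x = y + z"
      using orthogonal_subspace_decomp_exists by blast
    then have "y \<in> L" "z \<in> L\<^sup>\<bottom>"
      using flat_subspace[OF L] by (auto simp: orthogonal_comp_def orthogonal_commute span_eq_iff[THEN iffD2])
    then show "(\<Sum>P\<in>{P \<in> topes U N. ?c P L}. h P L) =
      ((\<lambda>y. \<Sum>K\<in>{K \<in> normal_flats. K \<subseteq> L}. \<bar>mobius normal_flats L K\<bar> * indicator K y)
       \<star> (\<lambda>y. \<Sum>M\<in>{M \<in> normal_flats. L \<subseteq> M}. \<bar>mobius normal_flats U M\<bar> * indicator (M\<^sup>\<bottom>) y)) x"
      unfolding h_def x by (simp only: sum_local_cells[OF L] cone_product_flats[OF L])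
  qed
  finally show ?thesis .
qed

end

text \<open>
  The normal is taken inside \<open>U\<close>, so that its zero set in \<open>U\<close> is a proper subspace.
\<close>

lemma hyperplane_normal:
  assumes "subspace U" "subspace H" "H \<subseteq> U" "dim H + 1 = dim U"
  shows "\<exists>a\<in>U - {0}. zero_locus U {a} = H"
proof -
  have "span H \<noteq> span U"
  proof
    assume "span H = span U"
    then have "dim H = dim U" by (metis dim_span)
    then show False using assms(4) by simp
  qed
  then have "span H \<subset> span U" using span_mono[OF assms(3)] by blast
  then obtain a where a: "a \<noteq> 0" "a \<in> span U" "\<And>y. y \<in> span H \<Longrightarrow> orthogonal a y"
    using orthogonal_to_subspace_exists_gen by blast
  have aU: "a \<in> U" using a(2) assms(1) by (simp add: span_eq_iff[THEN iffD2])
  have "H \<subseteq> zero_locus U {a}"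
    using assms(3) a(3) by (auto simp: zero_locus_def orthogonal_def span_base)
  moreover have "dim U = dim (zero_locus U {a}) + 1"
    using a(1) aU by (intro dim_zero_locus[OF assms(1), of a]) auto
  ultimately have "H = zero_locus U {a}"
    using assms by (intro subspace_dim_equal subspace_zero_locus) auto
  then show ?thesis using aU a(1) by blast
qed

lemma arrangement_has_normals:
  assumes "hyperplane_arrangement U \<A>"
  obtains N where "arrangement_normals U N" "\<A> = (\<lambda>a. zero_locus U {a}) ` N"
proof -
  have "\<forall>H\<in>\<A>. \<exists>a\<in>U - {0}. zero_locus U {a} = H"
    using assms hyperplane_normal unfolding hyperplane_arrangement_def by blast
  then obtain n where n: "\<And>H. H \<in> \<A> \<Longrightarrow> n H \<in> U - {0} \<and> zero_locus U {n H} = H" by metis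
  have "arrangement_normals U (n ` \<A>)"
    using assms n by unfold_locales (auto simp: hyperplane_arrangement_def)
  moreover have "\<A> = (\<lambda>a. zero_locus U {a}) ` n ` \<A>" using n by (auto simp: image_image)
  ultimately show ?thesis by (rule that)
qed

theorem theorem3p8:
  fixes U :: "(real ^ 'n) set" and \<A> :: "(real ^ 'n) set set" and k :: nat
  assumes "hyperplane_arrangement U \<A>" and "k \<le> CARD('n)"
  shows "V_arr k U \<A> =
    (\<lambda>x. \<Sum>L\<in>{L \<in> flats U \<A>. dim L = k}.
      ((\<lambda>y. \<Sum>K\<in>{K \<in> flats U \<A>. K \<subseteq> L}. \<bar>mobius (flats U \<A>) L K\<bar> * indicator K y)
       \<star> (\<lambda>y. \<Sum>M\<in>{M \<in> flats U \<A>. L \<subseteq> M}. \<bar>mobius (flats U \<A>) U M\<bar> * indicator (M\<^sup>\<bottom>) y)) x)"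
proof
  fix x
  obtain N where "arrangement_normals U N" and \<A>: "\<A> = (\<lambda>a. zero_locus U {a}) ` N"
    using arrangement_has_normals[OF assms(1)] .
  then interpret arrangement_normals U N by simp
  have "U \<inter> \<Inter>((\<lambda>a. zero_locus U {a}) ` B) = zero_locus U B" for B
    by (auto simp: zero_locus_def)
  then have "X \<in> flats U \<A> \<longleftrightarrow> (\<exists>B\<subseteq>N. X = zero_locus U B)" for X
    unfolding flats_def \<A> subset_image_iff mem_Collect_eq by metis
  then have flats: "flats U \<A> = normal_flats"
    unfolding normal_flats_def by blast
  have "U - \<Union>\<A> = {x \<in> U. \<forall>a\<in>N. a \<bullet> x \<noteq> 0}"
    unfolding \<A> by (auto simp: zero_locus_def)
  then have "arrangement_fan U \<A> = closed_cell U N ` topes U N"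
    unfolding arrangement_fan_def by (simp add: closures_of_chambers subspace_U finite_N)
  then have "V_arr k U \<A> x = (\<Sum>P\<in>topes U N. V_cone k (closed_cell U N P) x)"
    unfolding V_arr_def by (simp add: sum.reindex inj_on_closed_cell)
  then show "V_arr k U \<A> x =
    (\<Sum>L\<in>{L \<in> flats U \<A>. dim L = k}.
      ((\<lambda>y. \<Sum>K\<in>{K \<in> flats U \<A>. K \<subseteq> L}. \<bar>mobius (flats U \<A>) L K\<bar> * indicator K y)
       \<star> (\<lambda>y. \<Sum>M\<in>{M \<in> flats U \<A>. L \<subseteq> M}. \<bar>mobius (flats U \<A>) U M\<bar> * indicator (M\<^sup>\<bottom>) y)) x)"
    unfolding flats by (simp only: sum_V_cone)
qed

end
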